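(* The multiplier algebra of a $C^*$-algebra which has a properly infinite strictly positive element need not be properly infinite: there exists a $C^*$-algebra $A$ which contains a strictly positive element that is properly infinite, but for which the unit of the multiplier algebra $\mathcal{M}(A)$ is not a properly infinite projection.
   Context: A positive element $a$ of a $C^*$-algebra $A$ is properly infinite if its class in the Cuntz semigroup satisfies $\langle a\rangle=2\langle a\rangle$, equivalently $a\oplus a\precsim a$, where $\precsim$ denotes Cuntz subequivalence in $A\otimes\mathcal{K}$ ($x\precsim y$ iff $d_kyd_k^*\to x$ for some sequence $(d_k)$ in $A\otimes\mathcal{K}$) and $\mathcal{K}$ is the algebra of compact operators on a separable infinite-dimensional Hilbert space. A projection $p$ is properly infinite if it has two mutually orthogonal subprojections each Murray-von Neumann equivalent to $p$; a unital $C^*$-algebra is properly infinite if its unit is. *)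

theory Defs
  imports Complex_Main "HOL-Algebra.Module"
begin

section \<open>C*-algebras\<close>

definition complex_ring :: "complex ring" where
  "complex_ring = \<lparr>carrier = UNIV, mult = (*), one = 1, zero = 0, add = (+)\<rparr>"

text \<open>
  C*-algebras need not be unital. The field \<open>one\<close>, inherited from the library's ring record,
  carries no meaning unless the algebra has a unit; no axiom below mentions it.
\<close>

record 'a cstar_struct = "(complex, 'a) module" +
  adj :: "'a \<Rightarrow> 'a"
  cnorm :: "'a \<Rightarrow> real"

definition converges_in :: "'a cstar_struct \<Rightarrow> (nat \<Rightarrow> 'a) \<Rightarrow> 'a \<Rightarrow> bool" where
  "converges_in A s x \<longleftrightarrow> (\<lambda>n. cnorm A (s n \<ominus>\<^bsub>A\<^esub> x)) \<longlonglongrightarrow> 0"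

definition cauchy_in :: "'a cstar_struct \<Rightarrow> (nat \<Rightarrow> 'a) \<Rightarrow> bool" where
  "cauchy_in A s \<longleftrightarrow> (\<forall>e>0. \<exists>N. \<forall>m\<ge>N. \<forall>n\<ge>N. cnorm A (s m \<ominus>\<^bsub>A\<^esub> s n) < e)"

locale cstar_algebra = module complex_ring A for A :: "'a cstar_struct" (structure) +
  assumes mult_closed:
      "\<lbrakk>x \<in> carrier A; y \<in> carrier A\<rbrakk> \<Longrightarrow> x \<otimes> y \<in> carrier A"
    and mult_assoc:
      "\<lbrakk>x \<in> carrier A; y \<in> carrier A; z \<in> carrier A\<rbrakk> \<Longrightarrow> (x \<otimes> y) \<otimes> z = x \<otimes> (y \<otimes> z)"
    and mult_l_distr:
      "\<lbrakk>x \<in> carrier A; y \<in> carrier A; z \<in> carrier A\<rbrakk> \<Longrightarrow> (x \<oplus> y) \<otimes> z = x \<otimes> z \<oplus> y \<otimes> z"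
    and mult_r_distr:
      "\<lbrakk>x \<in> carrier A; y \<in> carrier A; z \<in> carrier A\<rbrakk> \<Longrightarrow> z \<otimes> (x \<oplus> y) = z \<otimes> x \<oplus> z \<otimes> y"
    and smult_mult_l:
      "\<lbrakk>x \<in> carrier A; y \<in> carrier A\<rbrakk> \<Longrightarrow> (c \<odot> x) \<otimes> y = c \<odot> (x \<otimes> y)"
    and smult_mult_r:
      "\<lbrakk>x \<in> carrier A; y \<in> carrier A\<rbrakk> \<Longrightarrow> x \<otimes> (c \<odot> y) = c \<odot> (x \<otimes> y)"
    and adj_closed: "x \<in> carrier A \<Longrightarrow> adj A x \<in> carrier A"
    and adj_adj: "x \<in> carrier A \<Longrightarrow> adj A (adj A x) = x"
    and adj_add:
      "\<lbrakk>x \<in> carrier A; y \<in> carrier A\<rbrakk> \<Longrightarrow> adj A (x \<oplus> y) = adj A x \<oplus> adj A y"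
    and adj_smult: "x \<in> carrier A \<Longrightarrow> adj A (c \<odot> x) = cnj c \<odot> adj A x"
    and adj_mult:
      "\<lbrakk>x \<in> carrier A; y \<in> carrier A\<rbrakk> \<Longrightarrow> adj A (x \<otimes> y) = adj A y \<otimes> adj A x"
    and cnorm_nonneg: "x \<in> carrier A \<Longrightarrow> 0 \<le> cnorm A x"
    and cnorm_eq_0: "x \<in> carrier A \<Longrightarrow> cnorm A x = 0 \<longleftrightarrow> x = \<zero>"
    and cnorm_triangle:
      "\<lbrakk>x \<in> carrier A; y \<in> carrier A\<rbrakk> \<Longrightarrow> cnorm A (x \<oplus> y) \<le> cnorm A x + cnorm A y"
    and cnorm_smult: "x \<in> carrier A \<Longrightarrow> cnorm A (c \<odot> x) = cmod c * cnorm A x"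
    and cnorm_mult:
      "\<lbrakk>x \<in> carrier A; y \<in> carrier A\<rbrakk> \<Longrightarrow> cnorm A (x \<otimes> y) \<le> cnorm A x * cnorm A y"
    and cstar_identity: "x \<in> carrier A \<Longrightarrow> cnorm A (adj A x \<otimes> x) = (cnorm A x)\<^sup>2"
    and complete:
      "\<lbrakk>\<And>n. s n \<in> carrier A; cauchy_in A s\<rbrakk> \<Longrightarrow> \<exists>x\<in>carrier A. converges_in A s x"

section \<open>Positive and strictly positive elements\<close>

definition positive_element :: "'a cstar_struct \<Rightarrow> 'a \<Rightarrow> bool" where
  "positive_element A a \<longleftrightarrow> (\<exists>x\<in>carrier A. a = adj A x \<otimes>\<^bsub>A\<^esub> x)"

definition linear_functional :: "'a cstar_struct \<Rightarrow> ('a \<Rightarrow> complex) \<Rightarrow> bool" where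
  "linear_functional A \<phi> \<longleftrightarrow>
     (\<forall>x\<in>carrier A. \<forall>y\<in>carrier A. \<phi> (x \<oplus>\<^bsub>A\<^esub> y) = \<phi> x + \<phi> y) \<and>
     (\<forall>c. \<forall>x\<in>carrier A. \<phi> (c \<odot>\<^bsub>A\<^esub> x) = c * \<phi> x)"

definition positive_functional :: "'a cstar_struct \<Rightarrow> ('a \<Rightarrow> complex) \<Rightarrow> bool" where
  "positive_functional A \<phi> \<longleftrightarrow> linear_functional A \<phi> \<and>
     (\<forall>a. positive_element A a \<longrightarrow> Im (\<phi> a) = 0 \<and> 0 \<le> Re (\<phi> a))"

text \<open>
  A positive element is strictly positive if every nonzero positive functional (equivalently,
  every state) is strictly positive on it.
\<close>

definition strictly_positive :: "'a cstar_struct \<Rightarrow> 'a \<Rightarrow> bool" where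
  "strictly_positive A h \<longleftrightarrow> positive_element A h \<and>
     (\<forall>\<phi>. positive_functional A \<phi> \<and> (\<exists>x\<in>carrier A. \<phi> x \<noteq> 0) \<longrightarrow> 0 < Re (\<phi> h))"

section \<open>The tensor product with the compact operators\<close>

text \<open>
  \<open>A \<otimes> K\<close> is the completion of the union of the matrix algebras \<open>M\<^sub>n(A)\<close>, embedded into each
  other as upper left corners. It is realised here by infinite matrices over \<open>A\<close>.

  The C*-norm of \<open>M\<^sub>n(A)\<close> is the operator norm for its action on the Hilbert \<open>A\<close>-module \<open>A\<^sup>n\<close>,
  whose norm is \<open>\<parallel>v\<parallel>\<^sup>2 = \<parallel>v\<^sub>1\<^sup>* v\<^sub>1 + \<dots> + v\<^sub>n\<^sup>* v\<^sub>n\<parallel>\<close>.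
\<close>

definition column_norm :: "'a cstar_struct \<Rightarrow> nat \<Rightarrow> (nat \<Rightarrow> 'a) \<Rightarrow> real" where
  "column_norm A n v = sqrt (cnorm A (finsum A (\<lambda>i. adj A (v i) \<otimes>\<^bsub>A\<^esub> v i) {..<n}))"

definition matrix_norm :: "'a cstar_struct \<Rightarrow> nat \<Rightarrow> (nat \<Rightarrow> nat \<Rightarrow> 'a) \<Rightarrow> real" where
  "matrix_norm A n x =
     Sup {column_norm A n (\<lambda>i. finsum A (\<lambda>j. x i j \<otimes>\<^bsub>A\<^esub> v j) {..<n}) | v.
            (\<forall>j. v j \<in> carrier A) \<and> column_norm A n v \<le> 1}"

definition inf_matrix_norm :: "'a cstar_struct \<Rightarrow> (nat \<Rightarrow> nat \<Rightarrow> 'a) \<Rightarrow> real" where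
  "inf_matrix_norm A x = (SUP n. matrix_norm A n x)"

definition bounded_matrices :: "'a cstar_struct \<Rightarrow> (nat \<Rightarrow> nat \<Rightarrow> 'a) set" where
  "bounded_matrices A =
     {x. (\<forall>i j. x i j \<in> carrier A) \<and> bdd_above (range (\<lambda>n. matrix_norm A n x))}"

definition corner_compl ::
    "'a cstar_struct \<Rightarrow> nat \<Rightarrow> (nat \<Rightarrow> nat \<Rightarrow> 'a) \<Rightarrow> nat \<Rightarrow> nat \<Rightarrow> 'a" where
  "corner_compl A n x = (\<lambda>i j. if i < n \<and> j < n then \<zero>\<^bsub>A\<^esub> else x i j)"

text \<open>
  The matrix \<open>corner_compl A n x\<close> is the difference of \<open>x\<close> and its upper left \<open>n \<times> n\<close> corner,
  so the carrier below consists of the norm limits of finite matrices. For matrices in this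
  carrier, the series that define the entries of a product converge in norm.
\<close>

definition stabilization :: "'a cstar_struct \<Rightarrow> (nat \<Rightarrow> nat \<Rightarrow> 'a) cstar_struct" where
  "stabilization A =
     \<lparr>carrier = {x \<in> bounded_matrices A.
                   (\<lambda>n. inf_matrix_norm A (corner_compl A n x)) \<longlonglongrightarrow> 0},
      mult = (\<lambda>x y i j. THE z. z \<in> carrier A \<and>
                converges_in A (\<lambda>n. finsum A (\<lambda>k. x i k \<otimes>\<^bsub>A\<^esub> y k j) {..<n}) z),
      one = undefined,
      zero = (\<lambda>i j. \<zero>\<^bsub>A\<^esub>),
      add = (\<lambda>x y i j. x i j \<oplus>\<^bsub>A\<^esub> y i j),
      smult = (\<lambda>c x i j. c \<odot>\<^bsub>A\<^esub> x i j),
      adj = (\<lambda>x i j. adj A (x j i)),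
      cnorm = inf_matrix_norm A\<rparr>"

section \<open>Cuntz comparison and properly infinite positive elements\<close>

definition cuntz_subequiv :: "'a cstar_struct \<Rightarrow> 'a \<Rightarrow> 'a \<Rightarrow> bool" where
  "cuntz_subequiv B x y \<longleftrightarrow>
     (\<exists>d. (\<forall>k. d k \<in> carrier B) \<and>
          converges_in B (\<lambda>k. d k \<otimes>\<^bsub>B\<^esub> y \<otimes>\<^bsub>B\<^esub> adj B (d k)) x)"

definition diag2 :: "'a cstar_struct \<Rightarrow> 'a \<Rightarrow> 'a \<Rightarrow> nat \<Rightarrow> nat \<Rightarrow> 'a" where
  "diag2 A a b = (\<lambda>i j. if i = 0 \<and> j = 0 then a else if i = 1 \<and> j = 1 then b else \<zero>\<^bsub>A\<^esub>)"

text \<open>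
  As an element of \<open>A \<otimes> K\<close>, \<open>a\<close> is identified with \<open>a \<otimes> e\<close> for the rank one projection \<open>e\<close>
  given by the upper left matrix unit.
\<close>

definition properly_infinite_element :: "'a cstar_struct \<Rightarrow> 'a \<Rightarrow> bool" where
  "properly_infinite_element A a \<longleftrightarrow> positive_element A a \<and>
     cuntz_subequiv (stabilization A) (diag2 A a a) (diag2 A a \<zero>\<^bsub>A\<^esub>)"

section \<open>Properly infinite projections\<close>

definition projection :: "'a cstar_struct \<Rightarrow> 'a \<Rightarrow> bool" where
  "projection A p \<longleftrightarrow> p \<in> carrier A \<and> adj A p = p \<and> p \<otimes>\<^bsub>A\<^esub> p = p"

definition subprojection :: "'a cstar_struct \<Rightarrow> 'a \<Rightarrow> 'a \<Rightarrow> bool" where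
  "subprojection A q p \<longleftrightarrow> projection A q \<and> projection A p \<and> p \<otimes>\<^bsub>A\<^esub> q = q"

definition mvn_equiv :: "'a cstar_struct \<Rightarrow> 'a \<Rightarrow> 'a \<Rightarrow> bool" where
  "mvn_equiv A p q \<longleftrightarrow> projection A p \<and> projection A q \<and>
     (\<exists>v\<in>carrier A. p = adj A v \<otimes>\<^bsub>A\<^esub> v \<and> q = v \<otimes>\<^bsub>A\<^esub> adj A v)"

definition properly_infinite_projection :: "'a cstar_struct \<Rightarrow> 'a \<Rightarrow> bool" where
  "properly_infinite_projection A p \<longleftrightarrow> projection A p \<and>
     (\<exists>q r. subprojection A q p \<and> subprojection A r p \<and> q \<otimes>\<^bsub>A\<^esub> r = \<zero>\<^bsub>A\<^esub> \<and>
            mvn_equiv A q p \<and> mvn_equiv A r p)"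

section \<open>The multiplier algebra\<close>

text \<open>
  The multiplier algebra is the algebra of double centralizers \<open>(L, R)\<close>; a multiplier \<open>c\<close>
  corresponds to \<open>L x = c x\<close> and \<open>R x = x c\<close>. Maps are taken to be \<open>undefined\<close> outside the
  carrier, so that equality of double centralizers is equality of pairs.
\<close>

definition bounded_linear_maps :: "'a cstar_struct \<Rightarrow> ('a \<Rightarrow> 'a) set" where
  "bounded_linear_maps A =
     {T \<in> carrier A \<rightarrow>\<^sub>E carrier A.
        (\<forall>x\<in>carrier A. \<forall>y\<in>carrier A. T (x \<oplus>\<^bsub>A\<^esub> y) = T x \<oplus>\<^bsub>A\<^esub> T y) \<and>
        (\<forall>c. \<forall>x\<in>carrier A. T (c \<odot>\<^bsub>A\<^esub> x) = c \<odot>\<^bsub>A\<^esub> T x) \<and>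
        (\<exists>C. \<forall>x\<in>carrier A. cnorm A (T x) \<le> C * cnorm A x)}"

definition double_centralizers :: "'a cstar_struct \<Rightarrow> (('a \<Rightarrow> 'a) \<times> ('a \<Rightarrow> 'a)) set" where
  "double_centralizers A =
     {(L, R). L \<in> bounded_linear_maps A \<and> R \<in> bounded_linear_maps A \<and>
        (\<forall>x\<in>carrier A. \<forall>y\<in>carrier A.
           L (x \<otimes>\<^bsub>A\<^esub> y) = L x \<otimes>\<^bsub>A\<^esub> y \<and>
           R (x \<otimes>\<^bsub>A\<^esub> y) = x \<otimes>\<^bsub>A\<^esub> R y \<and>
           R x \<otimes>\<^bsub>A\<^esub> y = x \<otimes>\<^bsub>A\<^esub> L y)}"

definition multiplier_algebra ::
    "'a cstar_struct \<Rightarrow> (('a \<Rightarrow> 'a) \<times> ('a \<Rightarrow> 'a)) cstar_struct" where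
  "multiplier_algebra A =
     \<lparr>carrier = double_centralizers A,
      mult = (\<lambda>(L1, R1) (L2, R2).
                (\<lambda>x\<in>carrier A. L1 (L2 x), \<lambda>x\<in>carrier A. R2 (R1 x))),
      one = (\<lambda>x\<in>carrier A. x, \<lambda>x\<in>carrier A. x),
      zero = (\<lambda>x\<in>carrier A. \<zero>\<^bsub>A\<^esub>, \<lambda>x\<in>carrier A. \<zero>\<^bsub>A\<^esub>),
      add = (\<lambda>(L1, R1) (L2, R2).
               (\<lambda>x\<in>carrier A. L1 x \<oplus>\<^bsub>A\<^esub> L2 x, \<lambda>x\<in>carrier A. R1 x \<oplus>\<^bsub>A\<^esub> R2 x)),
      smult = (\<lambda>c (L, R). (\<lambda>x\<in>carrier A. c \<odot>\<^bsub>A\<^esub> L x, \<lambda>x\<in>carrier A. c \<odot>\<^bsub>A\<^esub> R x)),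
      adj = (\<lambda>(L, R). (\<lambda>x\<in>carrier A. adj A (R (adj A x)),
                        \<lambda>x\<in>carrier A. adj A (L (adj A x)))),
      cnorm = (\<lambda>(L, R). Sup {cnorm A (L x) | x. x \<in> carrier A \<and> cnorm A x \<le> 1})\<rparr>"

lemma (in cstar_algebra) projection_multiplier_one:
  "projection (multiplier_algebra A) \<one>\<^bsub>multiplier_algebra A\<^esub>"
proof -
  have "restrict (\<lambda>x. x) (carrier A) \<in> bounded_linear_maps A"
    by (auto simp: bounded_linear_maps_def M.add.m_closed smult_closed complex_ring_def
             intro!: exI[of _ 1])
  then show ?thesis
    by (auto simp: projection_def multiplier_algebra_def double_centralizers_def mult_closed
        adj_closed adj_adj fun_eq_iff restrict_def)
qed

end

theory Submission
  imports "HOL-Analysis.Analysis" Defs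
begin

text \<open>
  On the orthogonal sum of countably many copies \<open>H\<^sub>n\<close> of \<open>\<ell>\<^sup>2\<close>, fix a unit vector \<open>e\<^sub>n\<close> in each
  \<open>H\<^sub>n\<close> and let \<open>A\<close> consist of the block diagonal operators \<open>T\<close> with \<open>T e\<^sub>n \<rightarrow> 0\<close> and
  \<open>T\<^sup>* e\<^sub>n \<rightarrow> 0\<close>. The projection \<open>q\<close> onto the complement of all \<open>e\<^sub>n\<close> lies in \<open>A\<close>, and
  \<open>(1 - q) A (1 - q)\<close> is a copy of \<open>c\<^sub>0\<close>. The operator \<open>h\<close> that acts as \<open>q\<close> on the range of
  \<open>q\<close> and multiplies \<open>e\<^sub>n\<close> by \<open>1 / (n + 1)\<close> is strictly positive. Two block diagonal isometries
  \<open>s\<^sub>0\<close>, \<open>s\<^sub>1\<close> with orthogonal ranges inside the range of \<open>q\<close> give \<open>d\<^sub>b = h\<^sup>1\<^sup>/\<^sup>2 s\<^sub>b\<^sup>*\<close>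
  in \<open>A\<close> with \<open>d\<^sub>b h d\<^sub>c\<^sup>* = \<delta>\<^sub>b\<^sub>c h\<close>, so \<open>h\<close> is properly infinite. A multiplier \<open>m\<close> of
  \<open>A\<close> satisfies \<open>q m e\<^sub>n \<rightarrow> 0\<close>, because \<open>q m\<close> lies in \<open>A\<close>. Hence an isometry in the multiplier
  algebra maps \<open>e\<^sub>n\<close> almost to a multiple of \<open>e\<^sub>n\<close>, and two of them cannot have orthogonal ranges.
\<close>

section \<open>The Hilbert space of square summable functions\<close>

text \<open>The type receives only a real inner product, the real part of the complex one, so that
  the library's bounded operators with their norm apply. Complex linearity is imposed separately by
  \<open>clinear_op\<close>.\<close>

typedef 'i ell2 = "{x :: 'i \<Rightarrow> complex. (\<lambda>i. (cmod (x i))\<^sup>2) summable_on UNIV}"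
  by (rule exI[of _ "\<lambda>_. 0"]) simp

setup_lifting type_definition_ell2

lemma square_summable_comparison:
  fixes x y :: "'i \<Rightarrow> complex"
  assumes "(\<lambda>i. (cmod (y i))\<^sup>2) summable_on UNIV" "\<And>i. cmod (x i) \<le> C * cmod (y i)"
  shows "(\<lambda>i. (cmod (x i))\<^sup>2) summable_on UNIV"
proof (rule summable_on_comparison_test)
  show "(\<lambda>i. C\<^sup>2 * (cmod (y i))\<^sup>2) summable_on UNIV"
    by (intro summable_on_cmult_right assms)
  show "(cmod (x i))\<^sup>2 \<le> C\<^sup>2 * (cmod (y i))\<^sup>2" for i
    using power_mono[OF assms(2)[of i], of 2] by (simp add: power_mult_distrib)
qed auto

lemma square_summable_add:
  fixes x y :: "'i \<Rightarrow> complex"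
  assumes "(\<lambda>i. (cmod (x i))\<^sup>2) summable_on UNIV" "(\<lambda>i. (cmod (y i))\<^sup>2) summable_on UNIV"
  shows "(\<lambda>i. (cmod (x i + y i))\<^sup>2) summable_on UNIV"
proof (rule summable_on_comparison_test)
  show "(\<lambda>i. 2 * (cmod (x i))\<^sup>2 + 2 * (cmod (y i))\<^sup>2) summable_on UNIV"
    by (intro summable_on_add summable_on_cmult_right assms)
  show "(cmod (x i + y i))\<^sup>2 \<le> 2 * (cmod (x i))\<^sup>2 + 2 * (cmod (y i))\<^sup>2" for i
  proof -
    have "(cmod (x i + y i))\<^sup>2 \<le> (cmod (x i) + cmod (y i))\<^sup>2"
      by (simp add: norm_triangle_ineq power_mono)
    also have "\<dots> \<le> 2 * (cmod (x i))\<^sup>2 + 2 * (cmod (y i))\<^sup>2"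
      using sum_squares_bound[of "cmod (x i)" "cmod (y i)"] by (simp add: power2_sum)
    finally show ?thesis .
  qed
qed auto

lemma summable_inner_ell2:
  fixes x y :: "'i ell2"
  shows "(\<lambda>i. inner (Rep_ell2 x i) (Rep_ell2 y i)) summable_on UNIV"
proof (rule abs_summable_summable, rule Infinite_Sum.abs_summable_on_comparison_test')
  show "(\<lambda>i. (cmod (Rep_ell2 x i))\<^sup>2 + (cmod (Rep_ell2 y i))\<^sup>2) summable_on UNIV"
    using Rep_ell2[of x] Rep_ell2[of y] by (intro summable_on_add) auto
  show "norm (inner (Rep_ell2 x i) (Rep_ell2 y i)) \<le> (cmod (Rep_ell2 x i))\<^sup>2 + (cmod (Rep_ell2 y i))\<^sup>2"
    for i
  proof -
    let ?a = "cmod (Rep_ell2 x i)" and ?b = "cmod (Rep_ell2 y i)"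
    have "norm (inner (Rep_ell2 x i) (Rep_ell2 y i)) \<le> ?a * ?b"
      by (simp add: Cauchy_Schwarz_ineq2)
    also have "\<dots> \<le> ?a\<^sup>2 + ?b\<^sup>2"
      using sum_squares_bound[of ?a ?b] mult_nonneg_nonneg[of ?a ?b, OF norm_ge_zero norm_ge_zero]
      by linarith
    finally show ?thesis .
  qed
qed

instantiation ell2 :: (type) real_inner
begin

lift_definition zero_ell2 :: "'a ell2" is "\<lambda>_. 0" by simp
lift_definition plus_ell2 :: "'a ell2 \<Rightarrow> 'a ell2 \<Rightarrow> 'a ell2" is "\<lambda>x y i. x i + y i"
  by (auto intro: square_summable_add)
lift_definition uminus_ell2 :: "'a ell2 \<Rightarrow> 'a ell2" is "\<lambda>x i. - x i" by simp
lift_definition minus_ell2 :: "'a ell2 \<Rightarrow> 'a ell2 \<Rightarrow> 'a ell2" is "\<lambda>x y i. x i - y i"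
  using square_summable_add[of _ "\<lambda>i. - (_ i)"] by fastforce
lift_definition scaleR_ell2 :: "real \<Rightarrow> 'a ell2 \<Rightarrow> 'a ell2" is "\<lambda>r x i. r *\<^sub>R x i"
  by (rule square_summable_comparison) (auto intro: order_refl)

definition inner_ell2 :: "'a ell2 \<Rightarrow> 'a ell2 \<Rightarrow> real" where
  "inner_ell2 x y = (\<Sum>\<^sub>\<infinity>i. inner (Rep_ell2 x i) (Rep_ell2 y i))"
definition norm_ell2 :: "'a ell2 \<Rightarrow> real" where "norm_ell2 x = sqrt (inner x x)"
definition dist_ell2 :: "'a ell2 \<Rightarrow> 'a ell2 \<Rightarrow> real" where "dist_ell2 x y = norm (x - y)"
definition sgn_ell2 :: "'a ell2 \<Rightarrow> 'a ell2" where "sgn_ell2 x = scaleR (inverse (norm x)) x"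
definition uniformity_ell2 :: "('a ell2 \<times> 'a ell2) filter" where
  "uniformity_ell2 = (INF e\<in>{0 <..}. principal {(x, y). dist x y < e})"
definition open_ell2 :: "'a ell2 set \<Rightarrow> bool" where
  "open_ell2 U \<longleftrightarrow> (\<forall>x\<in>U. eventually (\<lambda>(x', y). x' = x \<longrightarrow> y \<in> U) uniformity)"

instance
proof
  fix x y z :: "'a ell2" and r s :: real
  show "x + y + z = x + (y + z)" by transfer (auto simp: add.assoc)
  show "x + y = y + x" by transfer (auto simp: add.commute)
  show "0 + x = x" by transfer auto
  show "- x + x = 0" by transfer auto
  show "x - y = x + - y" by transfer auto
  show "r *\<^sub>R (x + y) = r *\<^sub>R x + r *\<^sub>R y" by transfer (auto simp: algebra_simps)
  show "(r + s) *\<^sub>R x = r *\<^sub>R x + s *\<^sub>R x" by transfer (auto simp: algebra_simps)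
  show "r *\<^sub>R s *\<^sub>R x = (r * s) *\<^sub>R x" by transfer auto
  show "1 *\<^sub>R x = x" by transfer auto
  show "dist x y = norm (x - y)" by (rule dist_ell2_def)
  show "sgn x = scaleR (inverse (norm x)) x" by (rule sgn_ell2_def)
  show "uniformity = (INF e\<in>{0 <..}. principal {(x, y). dist (x::'a ell2) y < e})"
    by (rule uniformity_ell2_def)
  show "open U \<longleftrightarrow> (\<forall>x\<in>U. eventually (\<lambda>(x', y). x' = x \<longrightarrow> y \<in> U) uniformity)"
    for U :: "'a ell2 set" by (rule open_ell2_def)
  show "inner x y = inner y x" by (simp add: inner_ell2_def inner_commute)
  show "inner (x + y) z = inner x z + inner y z"
    unfolding inner_ell2_def
    by (subst infsum_add[symmetric])
       (auto simp: summable_inner_ell2 plus_ell2.rep_eq inner_add_left)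
  show "inner (r *\<^sub>R x) y = r * inner x y"
    unfolding inner_ell2_def
    by (subst infsum_cmult_right[symmetric]) (auto simp: summable_inner_ell2 scaleR_ell2.rep_eq)
  show "0 \<le> inner x x"
    unfolding inner_ell2_def by (intro infsum_nonneg) auto
  show "inner x x = 0 \<longleftrightarrow> x = 0"
  proof
    assume "inner x x = 0"
    then have "inner (Rep_ell2 x i) (Rep_ell2 x i) = 0" for i
      unfolding inner_ell2_def
      by (intro nonneg_infsum_le_0D[where A = UNIV]) (auto simp: summable_inner_ell2)
    then show "x = 0"
      by (intro Rep_ell2_inject[THEN iffD1]) (auto simp: zero_ell2.rep_eq)
  qed (simp add: inner_ell2_def zero_ell2.rep_eq)
  show "norm x = sqrt (inner x x)" by (rule norm_ell2_def)
qed

end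

section \<open>Completeness of the sequence space\<close>

lemma ell2_eqI: "(\<And>i. Rep_ell2 x i = Rep_ell2 y i) \<Longrightarrow> x = y"
  by (intro Rep_ell2_inject[THEN iffD1]) auto

lemma norm_ell2_square: "(norm x)\<^sup>2 = (\<Sum>\<^sub>\<infinity>i. (cmod (Rep_ell2 x i))\<^sup>2)"
  by (simp add: power2_norm_eq_inner inner_ell2_def)

lemma sum_le_norm_ell2: "finite F \<Longrightarrow> (\<Sum>i\<in>F. (cmod (Rep_ell2 x i))\<^sup>2) \<le> (norm x)\<^sup>2"
  unfolding norm_ell2_square using Rep_ell2[of x] by (intro finite_sum_le_infsum) auto

lemma cmod_Rep_ell2_le: "cmod (Rep_ell2 x i) \<le> norm x"
  using sum_le_norm_ell2[of "{i}" x] by (simp add: power2_le_iff_abs_le)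

text \<open>A Cauchy sequence converges in every coordinate. The Cauchy estimate survives this limit
  on each finite set of coordinates, and a bound uniform in the finite set controls the infinite
  sum.\<close>

instance ell2 :: (type) banach
proof
  fix X :: "nat \<Rightarrow> 'a ell2"
  assume X: "Cauchy X"
  have "Cauchy (\<lambda>n. Rep_ell2 (X n) i)" for i
  proof (rule metric_CauchyI)
    fix e :: real assume "0 < e"
    then obtain M where "\<forall>m\<ge>M. \<forall>n\<ge>M. dist (X m) (X n) < e"
      using X by (meson metric_CauchyD)
    moreover have "dist (Rep_ell2 (X m) i) (Rep_ell2 (X n) i) \<le> dist (X m) (X n)" for m n
      using cmod_Rep_ell2_le[of "X m - X n" i] by (simp add: dist_norm minus_ell2.rep_eq)
    ultimately show "\<exists>M. \<forall>m\<ge>M. \<forall>n\<ge>M. dist (Rep_ell2 (X m) i) (Rep_ell2 (X n) i) < e"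
      by (meson le_less_trans)
  qed
  then have "\<forall>i. \<exists>l. (\<lambda>n. Rep_ell2 (X n) i) \<longlonglongrightarrow> l"
    by (auto simp: Cauchy_convergent_iff convergent_def)
  then obtain y where y: "\<And>i. (\<lambda>n. Rep_ell2 (X n) i) \<longlonglongrightarrow> y i"
    by metis
  have close: "(\<Sum>i\<in>F. (cmod (Rep_ell2 (X m) i - y i))\<^sup>2) \<le> e\<^sup>2"
    if "finite F" "m \<ge> M" "\<forall>m\<ge>M. \<forall>n\<ge>M. dist (X m) (X n) < e" for e M m F
  proof (rule tendsto_upperbound)
    show "(\<lambda>n. \<Sum>i\<in>F. (cmod (Rep_ell2 (X m) i - Rep_ell2 (X n) i))\<^sup>2) \<longlonglongrightarrow>
        (\<Sum>i\<in>F. (cmod (Rep_ell2 (X m) i - y i))\<^sup>2)"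
      by (intro tendsto_intros y)
    have "(\<Sum>i\<in>F. (cmod (Rep_ell2 (X m) i - Rep_ell2 (X n) i))\<^sup>2) \<le> e\<^sup>2" if "n \<ge> M" for n
    proof -
      have "(\<Sum>i\<in>F. (cmod (Rep_ell2 (X m) i - Rep_ell2 (X n) i))\<^sup>2) \<le> (norm (X m - X n))\<^sup>2"
        using sum_le_norm_ell2[OF \<open>finite F\<close>, of "X m - X n"] by (simp add: minus_ell2.rep_eq)
      also have "\<dots> \<le> e\<^sup>2"
        using \<open>\<forall>m\<ge>M. _\<close> \<open>m \<ge> M\<close> \<open>n \<ge> M\<close> by (intro power_mono) (auto simp: dist_norm less_imp_le)
      finally show ?thesis .
    qed
    then show "\<forall>\<^sub>F n in sequentially.
        (\<Sum>i\<in>F. (cmod (Rep_ell2 (X m) i - Rep_ell2 (X n) i))\<^sup>2) \<le> e\<^sup>2"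
      by (auto simp: eventually_sequentially)
  qed auto
  have diff_summable: "(\<lambda>i. (cmod (Rep_ell2 (X m) i - y i))\<^sup>2) summable_on UNIV"
    if "m \<ge> M" "\<forall>m\<ge>M. \<forall>n\<ge>M. dist (X m) (X n) < e" for e M m
    using close[OF _ that]
    by (intro nonneg_bdd_above_summable_on) (auto intro!: bdd_aboveI[of _ "e\<^sup>2"])
  obtain M1 where M1: "\<forall>m\<ge>M1. \<forall>n\<ge>M1. dist (X m) (X n) < 1"
    using X by (meson metric_CauchyD zero_less_one)
  \<comment> \<open>The limit \<open>y\<close> is \<open>X M1\<close> minus the difference
    \<open>X M1 - y\<close>, and both are square summable.\<close>
  have "(\<lambda>i. (cmod (Rep_ell2 (X M1) i + - (Rep_ell2 (X M1) i - y i)))\<^sup>2) summable_on UNIV"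
    using Rep_ell2[of "X M1"] diff_summable[OF order_refl M1]
    by (intro square_summable_add) (auto simp: norm_minus_commute)
  then have y_summable: "(\<lambda>i. (cmod (y i))\<^sup>2) summable_on UNIV" by simp
  define Y where "Y = Abs_ell2 y"
  have Y: "Rep_ell2 Y = y" unfolding Y_def using y_summable by (simp add: Abs_ell2_inverse)
  have "X \<longlonglongrightarrow> Y"
  proof (rule metric_LIMSEQ_I)
    fix e :: real assume "0 < e"
    then obtain M where M: "\<forall>m\<ge>M. \<forall>n\<ge>M. dist (X m) (X n) < e/2"
      using X by (meson metric_CauchyD half_gt_zero)
    have "dist (X m) Y < e" if "m \<ge> M" for m
    proof -
      have "(norm (X m - Y))\<^sup>2 \<le> (e/2)\<^sup>2"
        unfolding norm_ell2_square minus_ell2.rep_eq Y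
        using close[OF _ that M] diff_summable[OF that M] by (intro infsum_le_finite_sums) auto
      then have "norm (X m - Y) \<le> e/2"
        by (rule power2_le_imp_le) (use \<open>0 < e\<close> in simp)
      then show ?thesis using \<open>0 < e\<close> by (simp add: dist_norm)
    qed
    then show "\<exists>M. \<forall>m\<ge>M. dist (X m) Y < e" by blast
  qed
  then show "convergent X" by (rule convergentI)
qed

section \<open>Complex scalars on the real Hilbert space\<close>

lift_definition scaleC_ell2 :: "complex \<Rightarrow> 'i ell2 \<Rightarrow> 'i ell2" is "\<lambda>c x i. c * x i"
  by (rule square_summable_comparison[where C = "cmod _"]) (auto simp: norm_mult)

lemma scaleC_simps [simp]:
  "scaleC_ell2 c (x + y) = scaleC_ell2 c x + scaleC_ell2 c y"
  "scaleC_ell2 (c + d) x = scaleC_ell2 c x + scaleC_ell2 d x"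
  "scaleC_ell2 c (scaleC_ell2 d x) = scaleC_ell2 (c * d) x"
  "scaleC_ell2 1 x = x"
  by (transfer; auto simp: algebra_simps)+

lemma scaleC_of_real: "scaleC_ell2 (of_real r) x = r *\<^sub>R x"
  by transfer (auto simp: scaleR_conv_of_real)

lemma inner_scaleC: "inner (scaleC_ell2 c x) y = inner x (scaleC_ell2 (cnj c) y)"
  by (simp add: inner_ell2_def scaleC_ell2.rep_eq inner_complex_def algebra_simps)

lemma norm_scaleC: "norm (scaleC_ell2 c x) = cmod c * norm x"
proof -
  have "(norm (scaleC_ell2 c x))\<^sup>2 = (cmod c * norm x)\<^sup>2"
    using Rep_ell2[of x]
    by (simp add: norm_ell2_square scaleC_ell2.rep_eq norm_mult power_mult_distrib
        infsum_cmult_right)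
  then show ?thesis by simp
qed

section \<open>Adjointable operators\<close>

text \<open>Scalars become operators, so that scaling an operator is a composition and its laws are
  instances of associativity and commutation.\<close>

lift_definition scaleC_op :: "complex \<Rightarrow> 'i ell2 \<Rightarrow>\<^sub>L 'i ell2" is scaleC_ell2
proof (rule bounded_linear_intro)
  show "scaleC_ell2 c (r *\<^sub>R x) = r *\<^sub>R scaleC_ell2 c x" for c r and x :: "'i ell2"
    by (simp flip: scaleC_of_real add: mult.commute)
  show "norm (scaleC_ell2 c x) \<le> norm x * cmod c" for c and x :: "'i ell2"
    by (simp add: norm_scaleC)
qed simp

definition clinear_op :: "('i ell2 \<Rightarrow>\<^sub>L 'i ell2) \<Rightarrow> bool" where
  "clinear_op T \<longleftrightarrow> (\<forall>c x. T (scaleC_ell2 c x) = scaleC_ell2 c (T x))"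

text \<open>Adjoints are a relation, and their existence is demanded of the operators in the algebra
  instead of being derived by a representation theorem. For complex linear operators this adjoint
  for the real inner product is also the complex one.\<close>

definition has_adj :: "('a::real_inner \<Rightarrow>\<^sub>L 'a) \<Rightarrow> ('a \<Rightarrow>\<^sub>L 'a) \<Rightarrow> bool" where
  "has_adj T S \<longleftrightarrow> (\<forall>x y. inner (T x) y = inner x (S y))"

definition adj_op :: "('a::real_inner \<Rightarrow>\<^sub>L 'a) \<Rightarrow> ('a \<Rightarrow>\<^sub>L 'a)" where
  "adj_op T = (THE S. has_adj T S)"

lemma has_adj_sym: "has_adj T S \<Longrightarrow> has_adj S T"
  by (metis has_adj_def inner_commute)

lemma adj_op_eq:
  assumes "has_adj T S" shows "adj_op T = S"
  unfolding adj_op_def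
proof (rule the_equality[where a = S])
  fix S' assume "has_adj T S'"
  with assms have "inner x (S' y) = inner x (S y)" for x y by (simp add: has_adj_def)
  then show "S' = S" by (intro blinfun_eqI) (metis vector_eq_ldot)
qed (use assms in auto)

lemma has_adj_add: "has_adj T S \<Longrightarrow> has_adj T' S' \<Longrightarrow> has_adj (T + T') (S + S')"
  by (simp add: has_adj_def blinfun.add_left inner_add_left inner_add_right)

lemma has_adj_zero: "has_adj 0 0"
  by (simp add: has_adj_def)

lemma has_adj_compose: "has_adj T S \<Longrightarrow> has_adj T' S' \<Longrightarrow> has_adj (T o\<^sub>L T') (S' o\<^sub>L S)"
  by (simp add: has_adj_def)

lemma has_adj_scaleC: "has_adj (scaleC_op c) (scaleC_op (cnj c))"
  by (simp add: has_adj_def scaleC_op.rep_eq inner_scaleC)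

text \<open>The squared norm of \<open>T x\<close> is \<open>inner x (S (T x))\<close>, and
  Cauchy-Schwarz bounds it. This is the nontrivial half of the C*-identity.\<close>

lemma norm_square_le_compose_adj:
  assumes "has_adj T S" shows "(norm T)\<^sup>2 \<le> norm (S o\<^sub>L T)"
proof -
  have "norm T \<le> sqrt (norm (S o\<^sub>L T))"
  proof (rule norm_blinfun_bound)
    fix x
    have "(norm (T x))\<^sup>2 = inner x ((S o\<^sub>L T) x)"
      using assms by (simp add: has_adj_def power2_norm_eq_inner)
    also have "\<dots> \<le> norm x * norm ((S o\<^sub>L T) x)" by (rule norm_cauchy_schwarz)
    also have "\<dots> \<le> norm x * (norm (S o\<^sub>L T) * norm x)"
      by (intro mult_left_mono norm_blinfun) auto
    finally have "(norm (T x))\<^sup>2 \<le> (sqrt (norm (S o\<^sub>L T)) * norm x)\<^sup>2"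
      by (simp add: power_mult_distrib power2_eq_square algebra_simps)
    then show "norm (T x) \<le> sqrt (norm (S o\<^sub>L T)) * norm x"
      by (rule power2_le_imp_le) auto
  qed auto
  then have "(norm T)\<^sup>2 \<le> (sqrt (norm (S o\<^sub>L T)))\<^sup>2" by (intro power_mono) auto
  then show ?thesis by simp
qed

text \<open>The previous bound with submultiplicativity gives
  \<open>norm T * norm T \<le> norm S * norm T\<close>; cancel \<open>norm T\<close>, then exchange
  the roles of \<open>T\<close> and \<open>S\<close>.\<close>

lemma norm_adj:
  assumes "has_adj T S" shows "norm S = norm T"
proof -
  have "norm T \<le> norm S" if "has_adj T S" for T S :: "'a \<Rightarrow>\<^sub>L 'a"
  proof -
    have "norm T * norm T \<le> norm S * norm T"
      using norm_square_le_compose_adj[OF that] norm_blinfun_compose[of S T]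
      by (simp add: power2_eq_square)
    then show ?thesis
      by (metis linorder_not_le mult_strict_right_mono norm_ge_zero order_less_le_trans)
  qed
  from this[OF assms] this[OF has_adj_sym[OF assms]] show ?thesis by simp
qed

lemma norm_compose_adj:
  assumes "has_adj T S" shows "norm (S o\<^sub>L T) = (norm T)\<^sup>2"
proof (rule antisym)
  show "norm (S o\<^sub>L T) \<le> (norm T)\<^sup>2"
    using norm_blinfun_compose[of S T] norm_adj[OF assms] by (simp add: power2_eq_square)
qed (rule norm_square_le_compose_adj[OF assms])

lemma blinfun_compose_assoc: "(f o\<^sub>L g) o\<^sub>L h = f o\<^sub>L (g o\<^sub>L h)"
  by (rule blinfun_eqI) simp

lemma scaleC_op_simps:
  "scaleC_op (c + d) = scaleC_op c + scaleC_op d"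
  "scaleC_op (c * d) = scaleC_op c o\<^sub>L scaleC_op d"
  "scaleC_op 1 o\<^sub>L T = T"
  by (auto intro!: blinfun_eqI simp: scaleC_op.rep_eq blinfun.add_left)

lemma scaleC_op_commute: "clinear_op T \<Longrightarrow> T o\<^sub>L scaleC_op c = scaleC_op c o\<^sub>L T"
  by (auto intro!: blinfun_eqI simp: scaleC_op.rep_eq clinear_op_def)

lemma scaleC_op_minus_one: "scaleC_op (- 1) o\<^sub>L T = - T"
proof (rule blinfun_eqI)
  show "(scaleC_op (- 1) o\<^sub>L T) x = (- T) x" for x
    using scaleC_of_real[of "-1" "T x"] by (simp add: scaleC_op.rep_eq blinfun.minus_left)
qed

lemma norm_scaleC_op:
  fixes T :: "'i ell2 \<Rightarrow>\<^sub>L 'i ell2"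
  shows "norm (scaleC_op c o\<^sub>L T) = cmod c * norm T"
proof -
  have le: "norm (scaleC_op c o\<^sub>L T) \<le> cmod c * norm T" for c and T :: "'i ell2 \<Rightarrow>\<^sub>L 'i ell2"
  proof (rule norm_blinfun_bound)
    show "norm ((scaleC_op c o\<^sub>L T) x) \<le> cmod c * norm T * norm x" for x
      by (simp add: scaleC_op.rep_eq norm_scaleC mult.assoc mult_left_mono norm_blinfun)
  qed simp
  show ?thesis
  proof (cases "c = 0")
    case True
    then show ?thesis using le[of 0 T] by simp
  next
    case False
    \<comment> \<open>The reverse inequality is the upper bound applied to the inverse
      scalar.\<close>
    have "norm T = norm (scaleC_op (inverse c) o\<^sub>L (scaleC_op c o\<^sub>L T))"
      using False by (simp add: blinfun_compose_assoc[symmetric] scaleC_op_simps(2,3)[symmetric])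
        (simp add: scaleC_op_simps(3))
    also have "\<dots> \<le> cmod (inverse c) * norm (scaleC_op c o\<^sub>L T)" by (rule le)
    finally have "cmod c * norm T \<le> norm (scaleC_op c o\<^sub>L T)"
      using False by (simp add: inverse_eq_divide norm_divide field_simps)
    with le[of c T] show ?thesis by simp
  qed
qed

lemma cring_complex_ring: "cring complex_ring"
proof (intro cringI abelian_groupI comm_monoidI)
  show "\<exists>y\<in>carrier complex_ring. y \<oplus>\<^bsub>complex_ring\<^esub> x = \<zero>\<^bsub>complex_ring\<^esub>" for x
    by (auto simp: complex_ring_def intro: exI[of _ "- x"])
qed (auto simp: complex_ring_def algebra_simps)

section \<open>Concrete operator algebras\<close>

text \<open>\<open>S\<close> is a norm closed *-algebra of complex linear operators. The injection
  \<open>emb\<close> moves it into another type, because the carrier type in the theorem is not a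
  type of operators.\<close>

locale operator_algebra =
  fixes emb :: "('i ell2 \<Rightarrow>\<^sub>L 'i ell2) \<Rightarrow> 'a" and S :: "('i ell2 \<Rightarrow>\<^sub>L 'i ell2) set"
  assumes inj_emb: "inj emb"
    and zero_mem: "0 \<in> S"
    and add_mem: "\<lbrakk>f \<in> S; g \<in> S\<rbrakk> \<Longrightarrow> f + g \<in> S"
    and compose_mem: "\<lbrakk>f \<in> S; g \<in> S\<rbrakk> \<Longrightarrow> f o\<^sub>L g \<in> S"
    and scale_mem: "f \<in> S \<Longrightarrow> scaleC_op c o\<^sub>L f \<in> S"
    and clinear: "f \<in> S \<Longrightarrow> clinear_op f"
    and ex_adj: "f \<in> S \<Longrightarrow> \<exists>g\<in>S. has_adj f g"
    and closed: "closed S"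
begin

definition alg :: "'a cstar_struct" where
  "alg = \<lparr>carrier = emb ` S,
     mult = (\<lambda>x y. emb (the_inv emb x o\<^sub>L the_inv emb y)),
     one = undefined,
     zero = emb 0,
     add = (\<lambda>x y. emb (the_inv emb x + the_inv emb y)),
     smult = (\<lambda>c x. emb (scaleC_op c o\<^sub>L the_inv emb x)),
     adj = (\<lambda>x. emb (adj_op (the_inv emb x))),
     cnorm = (\<lambda>x. norm (the_inv emb x))\<rparr>"

lemma emb_mem_iff [simp]: "emb f \<in> carrier alg \<longleftrightarrow> f \<in> S"
  using inj_emb by (auto simp: alg_def inj_def the_inv_f_f)

lemma carrier_algE:
  assumes "x \<in> carrier alg" obtains f where "x = emb f" "f \<in> S"
  using assms by (auto simp: alg_def)

lemma alg_simps [simp]: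
  "emb f \<otimes>\<^bsub>alg\<^esub> emb g = emb (f o\<^sub>L g)"
  "emb f \<oplus>\<^bsub>alg\<^esub> emb g = emb (f + g)"
  "c \<odot>\<^bsub>alg\<^esub> emb f = emb (scaleC_op c o\<^sub>L f)"
  "adj alg (emb f) = emb (adj_op f)"
  "cnorm alg (emb f) = norm f"
  "\<zero>\<^bsub>alg\<^esub> = emb 0"
  "emb f = emb g \<longleftrightarrow> f = g"
  using inj_emb by (auto simp: alg_def inj_def the_inv_f_f)

lemma adj_mem: "f \<in> S \<Longrightarrow> adj_op f \<in> S"
  using ex_adj adj_op_eq by metis

lemma has_adj_adj_op: "f \<in> S \<Longrightarrow> has_adj f (adj_op f)"
  using ex_adj adj_op_eq by metis

lemma minus_mem: "f \<in> S \<Longrightarrow> - f \<in> S"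
  using scale_mem[of f "- 1"] by (simp add: scaleC_op_minus_one)

lemma abelian_group_alg: "abelian_group alg"
proof (rule abelian_groupI)
  fix x assume "x \<in> carrier alg"
  then obtain f where f: "x = emb f" "f \<in> S" by (rule carrier_algE)
  then show "\<exists>y\<in>carrier alg. y \<oplus>\<^bsub>alg\<^esub> x = \<zero>\<^bsub>alg\<^esub>"
    by (intro bexI[of _ "emb (- f)"]) (auto simp: minus_mem)
qed (auto elim!: carrier_algE simp: add_mem zero_mem algebra_simps)

lemma a_minus_alg:
  assumes "f \<in> S" "g \<in> S" shows "emb f \<ominus>\<^bsub>alg\<^esub> emb g = emb (f - g)"
proof -
  interpret abelian_group alg by (rule abelian_group_alg)
  have "\<ominus>\<^bsub>alg\<^esub> emb g = emb (- g)"
    using assms by (intro minus_equality) (auto simp: minus_mem)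
  then show ?thesis by (simp add: a_minus_def)
qed

lemma sum_mem: "(\<And>i. i \<in> F \<Longrightarrow> f i \<in> S) \<Longrightarrow> sum f F \<in> S"
  by (induction F rule: infinite_finite_induct) (auto simp: zero_mem add_mem)

lemma finsum_alg:
  assumes "finite F" "\<And>i. i \<in> F \<Longrightarrow> f i \<in> S"
  shows "finsum alg (\<lambda>i. emb (f i)) F = emb (sum f F)"
proof -
  interpret abelian_group alg by (rule abelian_group_alg)
  show ?thesis
    using assms by (induction F rule: finite_induct) (auto simp: finsum_insert finsum_empty Pi_def)
qed

lemma module_alg: "module complex_ring alg"
proof (rule moduleI)
  show "cring complex_ring" by (rule cring_complex_ring)
  show "abelian_group alg" by (rule abelian_group_alg)
  show "\<one>\<^bsub>complex_ring\<^esub> \<odot>\<^bsub>alg\<^esub> x = x" if "x \<in> carrier alg" for x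
    using that by (auto elim!: carrier_algE simp: complex_ring_def scaleC_op_simps)
qed (auto elim!: carrier_algE simp: complex_ring_def scale_mem scaleC_op_simps
      blinfun_compose_assoc bounded_bilinear.add_left[OF bounded_bilinear_blinfun_compose]
      bounded_bilinear.add_right[OF bounded_bilinear_blinfun_compose])

text \<open>All axioms are inherited from composition of operators: completeness from closedness of
  \<open>S\<close> in a Banach space, the C*-identity from \<open>norm_compose_adj\<close>.\<close>

lemma cstar_algebra_alg: "cstar_algebra alg"
proof (intro cstar_algebra.intro module_alg, unfold_locales)
  fix s assume s: "\<And>n. s n \<in> carrier alg" and c: "cauchy_in alg s"
  have "\<forall>n. \<exists>f. s n = emb f \<and> f \<in> S" using s by (metis carrier_algE)
  then obtain f where f: "\<And>n. s n = emb (f n)" "\<And>n. f n \<in> S" by metis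
  have "Cauchy f"
    using c by (simp add: cauchy_in_def f a_minus_alg Cauchy_def dist_norm)
  then obtain F where F: "f \<longlonglongrightarrow> F"
    using Cauchy_convergent_iff convergent_def by blast
  then have FS: "F \<in> S" using closed f(2) closed_sequential_limits by blast
  have "converges_in alg s (emb F)"
    using F by (simp add: converges_in_def f a_minus_alg FS LIM_zero tendsto_norm_zero)
  then show "\<exists>x\<in>carrier alg. converges_in alg s x" using FS by auto
next
  fix x assume "x \<in> carrier alg"
  then obtain f where f: "x = emb f" "f \<in> S" by (rule carrier_algE)
  show "adj alg x \<in> carrier alg" using f by (simp add: adj_mem)
  show "adj alg (adj alg x) = x"
    using f by (simp add: adj_op_eq has_adj_sym has_adj_adj_op)
  show "adj alg (c \<odot>\<^bsub>alg\<^esub> x) = cnj c \<odot>\<^bsub>alg\<^esub> adj alg x" for c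
    using f has_adj_compose[OF has_adj_scaleC has_adj_adj_op[OF f(2)], of c]
    by (simp add: adj_op_eq scaleC_op_commute clinear adj_mem)
  show "0 \<le> cnorm alg x" "cnorm alg x = 0 \<longleftrightarrow> x = \<zero>\<^bsub>alg\<^esub>"
    "cnorm alg (c \<odot>\<^bsub>alg\<^esub> x) = cmod c * cnorm alg x" for c
    using f by (auto simp: norm_scaleC_op)
  show "cnorm alg (adj alg x \<otimes>\<^bsub>alg\<^esub> x) = (cnorm alg x)\<^sup>2"
    using f by (simp add: norm_compose_adj has_adj_adj_op)
next
  fix x y assume "x \<in> carrier alg" "y \<in> carrier alg"
  then obtain f g where fg: "x = emb f" "f \<in> S" "y = emb g" "g \<in> S"
    by (auto elim!: carrier_algE)
  show "x \<otimes>\<^bsub>alg\<^esub> y \<in> carrier alg" using fg by (simp add: compose_mem)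
  show "(c \<odot>\<^bsub>alg\<^esub> x) \<otimes>\<^bsub>alg\<^esub> y = c \<odot>\<^bsub>alg\<^esub> (x \<otimes>\<^bsub>alg\<^esub> y)" for c
    using fg by (simp add: blinfun_compose_assoc)
  show "x \<otimes>\<^bsub>alg\<^esub> (c \<odot>\<^bsub>alg\<^esub> y) = c \<odot>\<^bsub>alg\<^esub> (x \<otimes>\<^bsub>alg\<^esub> y)" for c
    using fg by (simp add: blinfun_compose_assoc[symmetric] scaleC_op_commute clinear)
  show "adj alg (x \<oplus>\<^bsub>alg\<^esub> y) = adj alg x \<oplus>\<^bsub>alg\<^esub> adj alg y"
    using fg by (simp add: adj_op_eq has_adj_add has_adj_adj_op)
  show "adj alg (x \<otimes>\<^bsub>alg\<^esub> y) = adj alg y \<otimes>\<^bsub>alg\<^esub> adj alg x"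
    using fg by (simp add: adj_op_eq has_adj_compose has_adj_adj_op)
  show "cnorm alg (x \<oplus>\<^bsub>alg\<^esub> y) \<le> cnorm alg x + cnorm alg y"
    using fg by (simp add: norm_triangle_ineq)
  show "cnorm alg (x \<otimes>\<^bsub>alg\<^esub> y) \<le> cnorm alg x * cnorm alg y"
    using fg by (simp add: norm_blinfun_compose)
next
  fix x y z assume "x \<in> carrier alg" "y \<in> carrier alg" "z \<in> carrier alg"
  then obtain f g h where fgh: "x = emb f" "f \<in> S" "y = emb g" "g \<in> S" "z = emb h" "h \<in> S"
    by (auto elim!: carrier_algE)
  then show "(x \<otimes>\<^bsub>alg\<^esub> y) \<otimes>\<^bsub>alg\<^esub> z = x \<otimes>\<^bsub>alg\<^esub> (y \<otimes>\<^bsub>alg\<^esub> z)"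
    "(x \<oplus>\<^bsub>alg\<^esub> y) \<otimes>\<^bsub>alg\<^esub> z = x \<otimes>\<^bsub>alg\<^esub> z \<oplus>\<^bsub>alg\<^esub> y \<otimes>\<^bsub>alg\<^esub> z"
    "z \<otimes>\<^bsub>alg\<^esub> (x \<oplus>\<^bsub>alg\<^esub> y) = z \<otimes>\<^bsub>alg\<^esub> x \<oplus>\<^bsub>alg\<^esub> z \<otimes>\<^bsub>alg\<^esub> y"
    by (simp_all add: blinfun_compose_assoc
        bounded_bilinear.add_left[OF bounded_bilinear_blinfun_compose]
        bounded_bilinear.add_right[OF bounded_bilinear_blinfun_compose])
qed

end


section \<open>Finite matrices in the stabilization\<close>

lemma sum_lessThan_le_support:
  fixes c :: "nat \<Rightarrow> real"
  assumes "\<And>j. N \<le> j \<Longrightarrow> c j = 0" "\<And>j. 0 \<le> c j"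
  shows "sum c {..<n} \<le> sum c {..<N}"
proof -
  have "\<forall>i\<in>{..<n} - {..<n} \<inter> {..<N}. c i = 0"
    using assms(1) linorder_not_less by blast
  then have "sum c {..<n} = sum c ({..<n} \<inter> {..<N})"
    by (intro sum.mono_neutral_right) auto
  also have "\<dots> \<le> sum c {..<N}" by (intro sum_mono2) (auto simp: assms)
  finally show ?thesis .
qed

context operator_algebra
begin

lemma column_norm_alg:
  assumes "\<And>i. f i \<in> S"
  shows "column_norm alg n (\<lambda>i. emb (f i)) = sqrt (norm (\<Sum>i<n. adj_op (f i) o\<^sub>L f i))"
  using assms by (simp add: column_norm_def finsum_alg compose_mem adj_mem)

text \<open>As a quadratic form, the sum of all \<open>adj_op (f i) o\<^sub>L f i\<close> dominates
  each of its summands.\<close>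

lemma norm_entry_le_column_norm:
  assumes "\<And>i. f i \<in> S" "i < n"
  shows "norm (f i) \<le> column_norm alg n (\<lambda>i. emb (f i))"
proof -
  define s where "s = (\<Sum>i<n. adj_op (f i) o\<^sub>L f i)"
  have "norm (f i x) \<le> sqrt (norm s) * norm x" for x
  proof (rule power2_le_imp_le)
    have sq: "(norm (f i x))\<^sup>2 = inner x ((adj_op (f i) o\<^sub>L f i) x)" for i
      using has_adj_adj_op[OF assms(1)[of i]] by (simp add: has_adj_def power2_norm_eq_inner)
    have "(norm (f i x))\<^sup>2 \<le> (\<Sum>i<n. (norm (f i x))\<^sup>2)"
      using assms(2) by (intro member_le_sum) auto
    also have "\<dots> = inner x (s x)"
      unfolding s_def sq blinfun.sum_left inner_sum_right ..
    also have "\<dots> \<le> norm x * norm (s x)" by (rule norm_cauchy_schwarz)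
    also have "\<dots> \<le> norm x * (norm s * norm x)" by (intro mult_left_mono norm_blinfun) auto
    finally show "(norm (f i x))\<^sup>2 \<le> (sqrt (norm s) * norm x)\<^sup>2"
      by (simp add: power_mult_distrib power2_eq_square algebra_simps)
  qed auto
  then have "norm (f i) \<le> sqrt (norm s)" by (intro norm_blinfun_bound) auto
  then show ?thesis using assms(1) by (simp add: column_norm_alg s_def)
qed

lemma column_norm_le:
  assumes "\<And>i. f i \<in> S"
  shows "column_norm alg n (\<lambda>i. emb (f i)) \<le> sqrt (\<Sum>i<n. (norm (f i))\<^sup>2)"
proof -
  have "norm (\<Sum>i<n. adj_op (f i) o\<^sub>L f i) \<le> (\<Sum>i<n. (norm (f i))\<^sup>2)"
    by (intro sum_norm_le) (simp add: norm_compose_adj has_adj_adj_op assms)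
  then show ?thesis using assms by (simp add: column_norm_alg)
qed

definition emb_matrix :: "(nat \<Rightarrow> nat \<Rightarrow> 'i ell2 \<Rightarrow>\<^sub>L 'i ell2) \<Rightarrow> nat \<Rightarrow> nat \<Rightarrow> 'a" where
  "emb_matrix a = (\<lambda>i j. emb (a i j))"

definition finite_matrix :: "nat \<Rightarrow> (nat \<Rightarrow> nat \<Rightarrow> 'i ell2 \<Rightarrow>\<^sub>L 'i ell2) \<Rightarrow> bool" where
  "finite_matrix N a \<longleftrightarrow> (\<forall>i j. a i j \<in> S) \<and> (\<forall>i j. N \<le> i \<or> N \<le> j \<longrightarrow> a i j = 0)"

text \<open>Entries of a column of norm at most one have norm at most one, so row sums of entry
  norms give a crude bound. What matters is that it does not depend on \<open>n\<close>, which makes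
  the supremum over all corners finite.\<close>

lemma matrix_norm_finite:
  assumes "finite_matrix N a"
  defines "C \<equiv> sqrt (\<Sum>i<N. (\<Sum>j<N. norm (a i j))\<^sup>2)"
  shows "0 \<le> matrix_norm alg n (emb_matrix a)" "matrix_norm alg n (emb_matrix a) \<le> C"
proof -
  let ?X = "{column_norm alg n (\<lambda>i. finsum alg (\<lambda>j. emb_matrix a i j \<otimes>\<^bsub>alg\<^esub> v j) {..<n}) | v.
            (\<forall>j. v j \<in> carrier alg) \<and> column_norm alg n v \<le> 1}"
  have aS: "a i j \<in> S" and a0: "N \<le> i \<or> N \<le> j \<Longrightarrow> a i j = 0" for i j
    using assms by (auto simp: finite_matrix_def)
  have bound: "0 \<le> t \<and> t \<le> C" if t: "t \<in> ?X" for t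
  proof -
    obtain v where t_eq: "t = column_norm alg n (\<lambda>i. finsum alg (\<lambda>j. emb_matrix a i j \<otimes>\<^bsub>alg\<^esub> v j) {..<n})"
      and v: "\<And>j. v j \<in> carrier alg" "column_norm alg n v \<le> 1"
      using t by auto
    have "\<forall>j. \<exists>f. v j = emb f \<and> f \<in> S" using v(1) by (metis carrier_algE)
    then obtain f where "\<forall>j. v j = emb (f j) \<and> f j \<in> S" by metis
    then have f: "v = (\<lambda>j. emb (f j))" and fS: "\<And>j. f j \<in> S" by auto
    define g where "g = (\<lambda>i. \<Sum>j<n. a i j o\<^sub>L f j)"
    have gS: "g i \<in> S" for i unfolding g_def by (intro sum_mem compose_mem aS fS)
    have "t = column_norm alg n (\<lambda>i. emb (g i))"
      unfolding t_eq f by (simp add: emb_matrix_def finsum_alg compose_mem aS fS g_def)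
    also have "\<dots> \<le> sqrt (\<Sum>i<n. (norm (g i))\<^sup>2)"
      by (rule column_norm_le[OF gS])
    also have "\<dots> \<le> sqrt (\<Sum>i<n. (\<Sum>j<N. norm (a i j))\<^sup>2)"
    proof (intro real_sqrt_le_mono sum_mono power_mono)
      fix i
      have "norm (g i) \<le> (\<Sum>j<n. norm (a i j))"
        unfolding g_def
      proof (intro sum_norm_le)
        fix j assume "j \<in> {..<n}"
        then have "norm (f j) \<le> 1"
          using norm_entry_le_column_norm[of f j n] v(2) fS by (simp add: f)
        have "norm (a i j o\<^sub>L f j) \<le> norm (a i j) * norm (f j)" by (rule norm_blinfun_compose)
        also have "\<dots> \<le> norm (a i j) * 1"
          using \<open>norm (f j) \<le> 1\<close> by (intro mult_left_mono) auto
        finally show "norm (a i j o\<^sub>L f j) \<le> norm (a i j)" by simp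
      qed
      also have "\<dots> \<le> (\<Sum>j<N. norm (a i j))"
        by (rule sum_lessThan_le_support) (auto simp: a0)
      finally show "norm (g i) \<le> (\<Sum>j<N. norm (a i j))" .
    qed auto
    also have "\<dots> \<le> C"
      unfolding C_def by (intro real_sqrt_le_mono sum_lessThan_le_support) (auto simp: a0)
    finally show ?thesis
      unfolding t_eq by (simp add: column_norm_def)
        (auto simp: f emb_matrix_def finsum_alg compose_mem aS fS gS sum_mem adj_mem)
  qed
  \<comment> \<open>The zero column shows that the supremum is taken over a nonempty set.\<close>
  have "column_norm alg n (\<lambda>_. emb 0) \<le> 1"
    using column_norm_alg[of "\<lambda>_. 0" n] by (simp add: zero_mem)
  then have ex: "?X \<noteq> {}" using zero_mem by (auto intro!: exI[of _ "\<lambda>_. emb 0"])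
  then obtain t where t: "t \<in> ?X" by blast
  show "matrix_norm alg n (emb_matrix a) \<le> C"
    unfolding matrix_norm_def using ex bound by (intro cSup_least) blast+
  have "bdd_above ?X" using bound by (meson bdd_aboveI)
  then show "0 \<le> matrix_norm alg n (emb_matrix a)"
    unfolding matrix_norm_def using t bound[OF t] by (intro cSup_upper2[of t]) blast+
qed

section \<open>Arithmetic of finite matrices in the stabilization\<close>

lemma inf_matrix_norm_zero: "inf_matrix_norm alg (\<lambda>i j. emb 0) = 0"
proof -
  \<comment> \<open>With support size 0 the general bound is an empty sum, hence 0.\<close>
  have "finite_matrix 0 (\<lambda>i j. 0)" by (simp add: finite_matrix_def zero_mem)
  from matrix_norm_finite[OF this] have "matrix_norm alg n (\<lambda>i j. emb 0) = 0" for n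
    by (simp add: emb_matrix_def antisym)
  then show ?thesis by (simp add: inf_matrix_norm_def)
qed

text \<open>Once the corner contains the support, its complement is the zero matrix, so the limit
  condition holds trivially.\<close>

lemma finite_matrix_mem_stabilization:
  assumes "finite_matrix N a"
  shows "emb_matrix a \<in> carrier (stabilization alg)"
proof -
  have aS: "a i j \<in> S" and a0: "N \<le> i \<or> N \<le> j \<Longrightarrow> a i j = 0" for i j
    using assms by (auto simp: finite_matrix_def)
  have "corner_compl alg n (emb_matrix a) = (\<lambda>i j. emb 0)" if "N \<le> n" for n
    using that a0 by (auto simp: corner_compl_def emb_matrix_def fun_eq_iff)
  then have "inf_matrix_norm alg (corner_compl alg n (emb_matrix a)) = 0" if "N \<le> n" for n
    using that by (simp add: inf_matrix_norm_zero)
  then have "(\<lambda>n. inf_matrix_norm alg (corner_compl alg n (emb_matrix a))) \<longlonglongrightarrow> 0"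
    by (intro tendsto_eventually) (auto simp: eventually_sequentially)
  moreover have "bdd_above (range (\<lambda>n. matrix_norm alg n (emb_matrix a)))"
    using matrix_norm_finite(2)[OF assms] by (intro bdd_aboveI2)
  ultimately show ?thesis
    by (simp add: stabilization_def bounded_matrices_def) (simp add: emb_matrix_def aS)
qed

text \<open>The partial sums defining an entry are constant from \<open>N\<close> on, so the limit
  chosen by the description operator is the finite sum.\<close>

lemma mult_stabilization:
  assumes "finite_matrix N a" "finite_matrix N b"
  shows "emb_matrix a \<otimes>\<^bsub>stabilization alg\<^esub> emb_matrix b =
    emb_matrix (\<lambda>i j. \<Sum>k<N. a i k o\<^sub>L b k j)"
proof -
  have aS: "a i j \<in> S" and a0: "N \<le> j \<Longrightarrow> a i j = 0" and bS: "b i j \<in> S" for i j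
    using assms by (auto simp: finite_matrix_def)
  have "(THE z. z \<in> carrier alg \<and> converges_in alg
        (\<lambda>n. finsum alg (\<lambda>k. emb_matrix a i k \<otimes>\<^bsub>alg\<^esub> emb_matrix b k j) {..<n}) z) =
      emb (\<Sum>k<N. a i k o\<^sub>L b k j)" (is "(THE z. z \<in> _ \<and> converges_in _ ?s z) = emb ?c") for i j
  proof -
    have cS: "?c \<in> S" by (intro sum_mem compose_mem aS bS)
    have s: "?s = (\<lambda>n. emb (\<Sum>k<n. a i k o\<^sub>L b k j))"
      by (simp add: emb_matrix_def finsum_alg compose_mem aS bS)
    have conv: "converges_in alg ?s (emb f) \<longleftrightarrow> (\<lambda>n. \<Sum>k<n. a i k o\<^sub>L b k j) \<longlonglongrightarrow> f"
      if "f \<in> S" for f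
      unfolding s converges_in_def using that
      by (simp add: a_minus_alg sum_mem compose_mem aS bS tendsto_norm_zero_iff LIM_zero_iff)
    have "(\<Sum>k<n. a i k o\<^sub>L b k j) = ?c" if "N \<le> n" for n
      using that by (intro sum.mono_neutral_right) (auto simp: a0)
    then have lim: "(\<lambda>n. \<Sum>k<n. a i k o\<^sub>L b k j) \<longlonglongrightarrow> ?c"
      by (intro tendsto_eventually eventually_sequentiallyI[of N])
    show ?thesis
    proof (rule the_equality)
      show "emb ?c \<in> carrier alg \<and> converges_in alg ?s (emb ?c)"
        by (intro conjI iffD2[OF conv[OF cS] lim]) (simp add: cS)
    next
      fix z assume z: "z \<in> carrier alg \<and> converges_in alg ?s z"
      then obtain f where f: "z = emb f" "f \<in> S" by (blast elim: carrier_algE)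
      have "f = ?c"
        by (rule LIMSEQ_unique[OF iffD1[OF conv[OF f(2)]] lim]) (use z f in blast)
      then show "z = emb ?c" using f by simp
    qed
  qed
  then show ?thesis by (simp add: stabilization_def emb_matrix_def)
qed

lemma adj_stabilization:
  "adj (stabilization alg) (emb_matrix a) = emb_matrix (\<lambda>i j. adj_op (a j i))"
  by (simp add: stabilization_def emb_matrix_def)

text \<open>Subtraction unfolds to a definite description of an inverse over the whole carrier. Its
  value is determined entrywise, without proving the group laws for the stabilization.\<close>

lemma a_minus_self_stabilization:
  assumes "finite_matrix N a"
  shows "emb_matrix a \<ominus>\<^bsub>stabilization alg\<^esub> emb_matrix a = (\<lambda>i j. emb 0)"
proof -
  let ?B = "stabilization alg"
  have aS: "a i j \<in> S" for i j using assms by (auto simp: finite_matrix_def)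
  have "finite_matrix N (\<lambda>i j. - a i j)"
    using assms by (auto simp: finite_matrix_def minus_mem)
  note neg = finite_matrix_mem_stabilization[OF this]
  have "\<ominus>\<^bsub>?B\<^esub> emb_matrix a = emb_matrix (\<lambda>i j. - a i j)"
    unfolding a_inv_def m_inv_def
  proof (rule the_equality)
    show "emb_matrix (\<lambda>i j. - a i j) \<in> carrier (add_monoid ?B) \<and>
      emb_matrix a \<otimes>\<^bsub>add_monoid ?B\<^esub> emb_matrix (\<lambda>i j. - a i j) = \<one>\<^bsub>add_monoid ?B\<^esub> \<and>
      emb_matrix (\<lambda>i j. - a i j) \<otimes>\<^bsub>add_monoid ?B\<^esub> emb_matrix a = \<one>\<^bsub>add_monoid ?B\<^esub>"
      using neg by (simp add: stabilization_def) (simp add: emb_matrix_def)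
  next
    fix y assume y: "y \<in> carrier (add_monoid ?B) \<and>
      emb_matrix a \<otimes>\<^bsub>add_monoid ?B\<^esub> y = \<one>\<^bsub>add_monoid ?B\<^esub> \<and>
      y \<otimes>\<^bsub>add_monoid ?B\<^esub> emb_matrix a = \<one>\<^bsub>add_monoid ?B\<^esub>"
    show "y = emb_matrix (\<lambda>i j. - a i j)"
    proof (intro ext)
      fix i j
      have "y i j \<in> carrier alg"
        using y by (simp add: stabilization_def bounded_matrices_def)
      then obtain f where f: "y i j = emb f" by (blast elim: carrier_algE)
      have "y \<oplus>\<^bsub>?B\<^esub> emb_matrix a = \<zero>\<^bsub>?B\<^esub>" using y by simp
      then have "y i j \<oplus>\<^bsub>alg\<^esub> emb (a i j) = emb 0"
        by (simp add: stabilization_def emb_matrix_def fun_eq_iff)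
      then show "y i j = emb_matrix (\<lambda>i j. - a i j) i j"
        by (simp add: f emb_matrix_def eq_neg_iff_add_eq_0)
    qed
  qed
  then show ?thesis by (simp add: a_minus_def stabilization_def) (simp add: emb_matrix_def)
qed

text \<open>The column with entries \<open>d0\<close>, \<open>d1\<close> conjugates \<open>h\<close>
  in the upper left corner to the 2 by 2 matrix of all \<open>d\<^sub>b h d\<^sub>c\<^sup>*\<close>,
  which the equations make \<open>diag(h, h)\<close>. Cuntz subequivalence thus holds exactly, not
  only in the limit.\<close>

lemma properly_infinite_element_alg:
  assumes pos: "positive_element alg (emb h)" and S: "h \<in> S" "d0 \<in> S" "d1 \<in> S"
    and eqs: "d0 o\<^sub>L h o\<^sub>L adj_op d0 = h" "d1 o\<^sub>L h o\<^sub>L adj_op d1 = h"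
      "d0 o\<^sub>L h o\<^sub>L adj_op d1 = 0" "d1 o\<^sub>L h o\<^sub>L adj_op d0 = 0"
  shows "properly_infinite_element alg (emb h)"
proof -
  let ?B = "stabilization alg"
  \<comment> \<open>\<open>D\<close> is that column, \<open>X\<close> stands for \<open>h\<close> in
    the corner and \<open>Y\<close> for \<open>diag(h, h)\<close>.\<close>
  define D where "D = (\<lambda>(i::nat) (j::nat). if j = 0 then if i = 0 then d0 else if i = 1 then d1 else 0 else 0)"
  define X where "X = (\<lambda>(i::nat) (j::nat). if i = 0 \<and> j = 0 then h else 0)"
  define Y where "Y = (\<lambda>(i::nat) (j::nat). if i = 0 \<and> j = 0 \<or> i = 1 \<and> j = 1 then h else 0)"
  have adj0: "adj_op 0 = (0 :: 'i ell2 \<Rightarrow>\<^sub>L 'i ell2)" by (rule adj_op_eq[OF has_adj_zero])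
  have sum2: "sum t {..<2} = t 0 + t (Suc 0)" for t :: "nat \<Rightarrow> 'i ell2 \<Rightarrow>\<^sub>L 'i ell2"
    by (simp add: numeral_2_eq_2 lessThan_Suc add.commute)
  have fin: "finite_matrix 2 D" "finite_matrix 2 X" "finite_matrix 2 Y"
    "finite_matrix 2 (\<lambda>i j. adj_op (D j i))"
    using S by (auto simp: finite_matrix_def D_def X_def Y_def zero_mem adj_mem adj0)
  have DX: "emb_matrix D \<otimes>\<^bsub>?B\<^esub> emb_matrix X =
      emb_matrix (\<lambda>i j. \<Sum>k<2. D i k o\<^sub>L X k j)"
    by (rule mult_stabilization[OF fin(1,2)])
  have fin': "finite_matrix 2 (\<lambda>i j. \<Sum>k<2. D i k o\<^sub>L X k j)"
    using fin(1,2) by (auto simp: finite_matrix_def intro!: sum_mem compose_mem)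
  have "emb_matrix D \<otimes>\<^bsub>?B\<^esub> emb_matrix X \<otimes>\<^bsub>?B\<^esub> adj ?B (emb_matrix D) =
      emb_matrix (\<lambda>i j. \<Sum>l<2. (\<Sum>k<2. D i k o\<^sub>L X k l) o\<^sub>L adj_op (D j l))"
    unfolding DX adj_stabilization by (rule mult_stabilization[OF fin' fin(4)])
  also have "(\<lambda>i j. \<Sum>l<2. (\<Sum>k<2. D i k o\<^sub>L X k l) o\<^sub>L adj_op (D j l)) = Y"
    unfolding sum2 by (intro ext) (auto simp: D_def X_def Y_def adj0 eqs)
  finally have DXD: "emb_matrix D \<otimes>\<^bsub>?B\<^esub> emb_matrix X \<otimes>\<^bsub>?B\<^esub> adj ?B (emb_matrix D) = emb_matrix Y" .
  have "diag2 alg (emb h) (emb h) = emb_matrix Y" "diag2 alg (emb h) \<zero>\<^bsub>alg\<^esub> = emb_matrix X"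
    by (auto simp: diag2_def emb_matrix_def X_def Y_def fun_eq_iff)
  moreover have "cuntz_subequiv ?B (emb_matrix Y) (emb_matrix X)"
    unfolding cuntz_subequiv_def
  \<comment> \<open>A constant sequence suffices, since the conjugate equals
    \<open>Y\<close>.\<close>
  proof (intro exI[of _ "\<lambda>_. emb_matrix D"] conjI allI)
    show "emb_matrix D \<in> carrier ?B" by (rule finite_matrix_mem_stabilization[OF fin(1)])
    show "converges_in ?B (\<lambda>k. emb_matrix D \<otimes>\<^bsub>?B\<^esub> emb_matrix X \<otimes>\<^bsub>?B\<^esub> adj ?B (emb_matrix D))
        (emb_matrix Y)"
      unfolding DXD converges_in_def a_minus_self_stabilization[OF fin(3)]
      using inf_matrix_norm_zero by (simp add: stabilization_def)
  qed
  ultimately show ?thesis using pos by (simp add: properly_infinite_element_def)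
qed

end


section \<open>Weighted composition operators\<close>

lift_definition unit_ell2 :: "'i \<Rightarrow> 'i ell2" is "\<lambda>k i. if i = k then 1 else 0"
proof -
  fix k :: 'i
  have "(\<lambda>i. (cmod (if i = k then 1 else 0))\<^sup>2) summable_on {k}" by simp
  then show "(\<lambda>i. (cmod (if i = k then 1 else 0))\<^sup>2) summable_on UNIV"
    by (rule summable_on_cong_neutral[THEN iffD1, rotated 3]) auto
qed

lemma inner_unit_ell2: "inner (scaleC_ell2 c (unit_ell2 k)) y = inner c (Rep_ell2 y k)"
proof -
  have "inner (scaleC_ell2 c (unit_ell2 k)) y = (\<Sum>\<^sub>\<infinity>i\<in>{k}. inner c (Rep_ell2 y i))"
    unfolding inner_ell2_def
    by (rule infsum_cong_neutral) (auto simp: scaleC_ell2.rep_eq unit_ell2.rep_eq)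
  then show ?thesis by simp
qed

lemma norm_unit_ell2 [simp]: "norm (unit_ell2 k) = 1"
  using inner_unit_ell2[of 1 k "unit_ell2 k"]
  by (simp add: unit_ell2.rep_eq norm_eq_sqrt_inner inner_complex_def)

text \<open>One form covers the diagonal operators (\<open>f\<close> the identity) and the operators
  \<open>squeeze\<close> and \<open>stretch\<close> below. \<open>Blinfun\<close> yields the
  intended map only if that map is bounded, so the facts about it assume a bounded weight and
  injectivity of \<open>f\<close> on its support.\<close>

definition weighted_comp :: "('i \<Rightarrow> complex) \<Rightarrow> ('i \<Rightarrow> 'i) \<Rightarrow> 'i ell2 \<Rightarrow>\<^sub>L 'i ell2" where
  "weighted_comp a f = Blinfun (\<lambda>x. Abs_ell2 (\<lambda>i. a i * Rep_ell2 x (f i)))"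

text \<open>Injectivity on the support means that each coordinate of \<open>x\<close> is used at
  most once, so the norm grows at most by the factor \<open>C\<close>.\<close>

lemma Rep_weighted_comp:
  assumes a: "\<And>i. cmod (a i) \<le> C" and f: "inj_on f {i. a i \<noteq> 0}"
  shows "Rep_ell2 (weighted_comp a f x) i = a i * Rep_ell2 x (f i)"
proof -
  have C: "0 \<le> C" using a[of undefined] norm_ge_zero by (rule order_trans[rotated])
  have main: "(\<lambda>i. (cmod (a i * Rep_ell2 x (f i)))\<^sup>2) summable_on UNIV \<and>
      (\<Sum>\<^sub>\<infinity>i. (cmod (a i * Rep_ell2 x (f i)))\<^sup>2) \<le> (C * norm x)\<^sup>2" for x
  proof -
    have x: "(\<lambda>j. (cmod (Rep_ell2 x j))\<^sup>2) summable_on UNIV" using Rep_ell2[of x] by simp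
    have le: "(\<Sum>i\<in>F. (cmod (a i * Rep_ell2 x (f i)))\<^sup>2) \<le> (C * norm x)\<^sup>2" if "finite F" for F
    proof -
      let ?G = "F \<inter> {i. a i \<noteq> 0}"
      have "(\<Sum>i\<in>F. (cmod (a i * Rep_ell2 x (f i)))\<^sup>2) =
          (\<Sum>i\<in>?G. (cmod (a i * Rep_ell2 x (f i)))\<^sup>2)"
        using that by (intro sum.mono_neutral_right) auto
      also have "\<dots> \<le> (\<Sum>i\<in>?G. C\<^sup>2 * (cmod (Rep_ell2 x (f i)))\<^sup>2)"
        by (intro sum_mono) (auto simp: norm_mult power_mult_distrib a intro!: mult_right_mono power_mono)
      also have "\<dots> = C\<^sup>2 * (\<Sum>j\<in>f ` ?G. (cmod (Rep_ell2 x j))\<^sup>2)"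
        using f by (subst sum.reindex) (auto simp: sum_distrib_left inj_on_def)
      also have "\<dots> \<le> C\<^sup>2 * (norm x)\<^sup>2"
        using that by (intro mult_left_mono sum_le_norm_ell2) auto
      finally show ?thesis by (simp add: power_mult_distrib)
    qed
    have "(\<lambda>i. (cmod (a i * Rep_ell2 x (f i)))\<^sup>2) summable_on UNIV"
      by (rule nonneg_bdd_above_summable_on) (auto intro!: bdd_aboveI le)
    then show ?thesis using le by (auto intro!: infsum_le_finite_sums)
  qed
  define F where "F = (\<lambda>x. Abs_ell2 (\<lambda>i. a i * Rep_ell2 x (f i)))"
  have Rep: "Rep_ell2 (F x) = (\<lambda>i. a i * Rep_ell2 x (f i))" for x
    unfolding F_def using main by (intro Abs_ell2_inverse) simp
  have "bounded_linear F"
  proof (rule bounded_linear_intro)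
    show "norm (F x) \<le> norm x * C" for x
    proof (rule power2_le_imp_le)
      show "(norm (F x))\<^sup>2 \<le> (norm x * C)\<^sup>2"
        unfolding norm_ell2_square Rep using main[of x] by (simp add: mult.commute)
    qed (use C in simp)
  qed (auto intro!: ell2_eqI simp: Rep plus_ell2.rep_eq scaleR_ell2.rep_eq algebra_simps)
  then show ?thesis
    using Rep by (simp add: weighted_comp_def bounded_linear_Blinfun_apply flip: F_def)
qed

section \<open>Adjoints and diagonal operators\<close>

definition mult_op :: "('i \<Rightarrow> complex) \<Rightarrow> 'i ell2 \<Rightarrow>\<^sub>L 'i ell2" where
  "mult_op a = weighted_comp a (\<lambda>i. i)"

lemma Rep_mult_op: "bounded (range a) \<Longrightarrow> Rep_ell2 (mult_op a x) i = a i * Rep_ell2 x i"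
  unfolding mult_op_def by (auto simp: bounded_iff intro: Rep_weighted_comp)

text \<open>Reindexing the inner product along \<open>f\<close> moves the weight to the other side.
  The case distinction makes \<open>b\<close> vanish off the image under \<open>f\<close> of the
  support of \<open>a\<close>, where \<open>g\<close> need not invert \<open>f\<close>.\<close>

lemma has_adj_weighted_comp:
  assumes a: "\<And>i. cmod (a i) \<le> C"
    and b: "\<And>j. b j = (if a (g j) \<noteq> 0 \<and> f (g j) = j then cnj (a (g j)) else 0)"
    and gf: "\<And>i. a i \<noteq> 0 \<Longrightarrow> g (f i) = i"
  shows "has_adj (weighted_comp a f) (weighted_comp b g)"
proof -
  have C: "0 \<le> C" using a[of undefined] norm_ge_zero by (rule order_trans[rotated])
  have bC: "cmod (b j) \<le> C" for j using a C by (simp add: b)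
  have f: "inj_on f {i. a i \<noteq> 0}" by (metis (mono_tags) gf inj_on_inverseI mem_Collect_eq)
  have g: "inj_on g {j. b j \<noteq> 0}"
    by (rule inj_on_inverseI[where g = f]) (auto simp: b split: if_splits)
  show ?thesis
    unfolding has_adj_def
  proof (intro allI)
    fix x y :: "'a ell2"
    have "inner (weighted_comp a f x) y =
        (\<Sum>\<^sub>\<infinity>i\<in>{i. a i \<noteq> 0}. inner (a i * Rep_ell2 x (f i)) (Rep_ell2 y i))"
      unfolding inner_ell2_def Rep_weighted_comp[OF a f] by (rule infsum_cong_neutral) auto
    also have "\<dots> = (\<Sum>\<^sub>\<infinity>j\<in>{j. b j \<noteq> 0}. inner (Rep_ell2 x j) (b j * Rep_ell2 y (g j)))"
    proof (rule infsum_reindex_bij_witness[where j = f and i = g])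
      show "f i \<in> {j. b j \<noteq> 0}" if "i \<in> {i. a i \<noteq> 0}" for i using that by (simp add: b gf)
      show "g j \<in> {i. a i \<noteq> 0}" if "j \<in> {j. b j \<noteq> 0}" for j
        using that by (auto simp: b split: if_splits)
      show "inner (Rep_ell2 x (f i)) (b (f i) * Rep_ell2 y (g (f i))) =
          inner (a i * Rep_ell2 x (f i)) (Rep_ell2 y i)" if "i \<in> {i. a i \<noteq> 0}" for i
        using that by (simp add: b gf inner_complex_def algebra_simps)
      show "g (f i) = i" if "i \<in> {i. a i \<noteq> 0}" for i using that by (simp add: gf)
      show "f (g j) = j" if "j \<in> {j. b j \<noteq> 0}" for j using that by (auto simp: b split: if_splits)
    qed
    also have "\<dots> = inner x (weighted_comp b g y)"
      unfolding inner_ell2_def Rep_weighted_comp[OF bC g] by (rule infsum_cong_neutral) auto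
    finally show "inner (weighted_comp a f x) y = inner x (weighted_comp b g y)" .
  qed
qed

lemma clinear_weighted_comp:
  assumes "\<And>i. cmod (a i) \<le> C" "inj_on f {i. a i \<noteq> 0}"
  shows "clinear_op (weighted_comp a f)"
  by (auto simp: clinear_op_def Rep_weighted_comp[OF assms] scaleC_ell2.rep_eq intro!: ell2_eqI)

lemma has_adj_mult_op:
  assumes "bounded (range a)" shows "has_adj (mult_op a) (mult_op (\<lambda>i. cnj (a i)))"
proof -
  obtain C where "\<And>i. cmod (a i) \<le> C" using assms by (auto simp: bounded_iff)
  then show ?thesis unfolding mult_op_def by (rule has_adj_weighted_comp) auto
qed

lemma clinear_mult_op: "bounded (range a) \<Longrightarrow> clinear_op (mult_op a)"
  by (auto simp: clinear_op_def Rep_mult_op scaleC_ell2.rep_eq intro!: ell2_eqI)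

lemma mult_op_add:
  assumes "bounded (range a)" "bounded (range b)"
  shows "mult_op (\<lambda>i. a i + b i) = mult_op a + mult_op b"
  using assms
  by (auto intro!: blinfun_eqI ell2_eqI simp: Rep_mult_op Rep_mult_op[OF bounded_plus_comp[OF assms]]
      blinfun.add_left plus_ell2.rep_eq algebra_simps)

lemma bounded_range_mult:
  fixes a b :: "'i \<Rightarrow> complex"
  assumes "bounded (range a)" "bounded (range b)"
  shows "bounded (range (\<lambda>i. a i * b i))"
proof -
  obtain A B where A: "\<And>i. cmod (a i) \<le> A" and B: "\<And>i. cmod (b i) \<le> B"
    using assms by (auto simp: bounded_iff)
  have "cmod (a i * b i) \<le> A * B" for i
    using A B by (auto simp: norm_mult intro!: mult_mono intro: order_trans[OF norm_ge_zero])
  then show ?thesis by (auto simp: bounded_iff)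
qed

lemma mult_op_mult:
  assumes "bounded (range a)" "bounded (range b)"
  shows "mult_op a o\<^sub>L mult_op b = mult_op (\<lambda>i. a i * b i)"
  using assms
  by (auto intro!: blinfun_eqI ell2_eqI simp: Rep_mult_op bounded_range_mult)

lemma mult_op_scale:
  assumes "bounded (range a)"
  shows "scaleC_op c o\<^sub>L mult_op a = mult_op (\<lambda>i. c * a i)"
  using assms bounded_range_mult[of "\<lambda>_. c" a]
  by (auto intro!: blinfun_eqI ell2_eqI simp: Rep_mult_op scaleC_op.rep_eq scaleC_ell2.rep_eq)

section \<open>Block diagonal operators that vanish at the base vectors\<close>

type_synonym ix = "nat \<times> nat"

abbreviation unit0 :: "nat \<Rightarrow> ix ell2" where "unit0 n \<equiv> unit_ell2 (n, 0)"

definition block :: "nat \<Rightarrow> ix ell2 \<Rightarrow>\<^sub>L ix ell2" where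
  "block n = mult_op (\<lambda>i. if fst i = n then 1 else 0)"

text \<open>This is \<open>A\<close> of the overview; commuting with every \<open>block n\<close>
  expresses block diagonality. As \<open>adj_op\<close> is a definite description, existence of an
  adjoint is a clause of its own.\<close>

definition block_ops :: "(ix ell2 \<Rightarrow>\<^sub>L ix ell2) set" where
  "block_ops = {T. clinear_op T \<and> (\<exists>T'. has_adj T T') \<and>
     (\<forall>n. T o\<^sub>L block n = block n o\<^sub>L T) \<and>
     (\<lambda>n. T (unit0 n)) \<longlonglongrightarrow> 0 \<and> (\<lambda>n. adj_op T (unit0 n)) \<longlonglongrightarrow> 0}"

lemma bounded_range_bool: "bounded (range (\<lambda>i. if P i then 1 else (0::complex)))"
  by (auto simp: bounded_iff intro!: exI[of _ 1])

lemma Rep_block: "Rep_ell2 (block n x) i = (if fst i = n then Rep_ell2 x i else 0)"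
  by (simp add: block_def Rep_mult_op[OF bounded_range_bool])

lemma has_adj_block: "has_adj (block n) (block n)"
  using has_adj_mult_op[OF bounded_range_bool[of "\<lambda>i::ix. fst i = n"]]
  by (simp add: block_def if_distrib[of cnj] cong: if_cong)

lemma has_adj_unique: "has_adj T S \<Longrightarrow> has_adj T S' \<Longrightarrow> S = S'"
  using adj_op_eq by metis

lemma block_opsI:
  assumes "clinear_op T" "has_adj T T'" "\<And>n. T o\<^sub>L block n = block n o\<^sub>L T"
    "(\<lambda>n. T (unit0 n)) \<longlonglongrightarrow> 0" "(\<lambda>n. T' (unit0 n)) \<longlonglongrightarrow> 0"
  shows "T \<in> block_ops"
  using assms adj_op_eq[OF assms(2)] by (auto simp: block_ops_def)

lemma block_opsD:
  assumes "T \<in> block_ops"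
  shows "clinear_op T" "has_adj T (adj_op T)" "T o\<^sub>L block n = block n o\<^sub>L T"
    "(\<lambda>n. T (unit0 n)) \<longlonglongrightarrow> 0" "(\<lambda>n. adj_op T (unit0 n)) \<longlonglongrightarrow> 0"
  using assms adj_op_eq by (auto simp: block_ops_def)

text \<open>Take adjoints on both sides: \<open>block n\<close> is its own adjoint and adjoints are
  unique.\<close>

lemma block_adj_commute:
  assumes "has_adj T T'" "T o\<^sub>L block n = block n o\<^sub>L T"
  shows "T' o\<^sub>L block n = block n o\<^sub>L T'"
  using has_adj_unique[OF has_adj_compose[OF assms(1) has_adj_block[of n]]]
    has_adj_compose[OF has_adj_block[of n] assms(1)] assms(2) by metis

text \<open>Complex linearity is commutation with all \<open>scaleC_op c\<close>, so the same
  passage to adjoints applies, with conjugated scalars.\<close>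

lemma clinear_adj:
  assumes "has_adj T T'" "clinear_op T" shows "clinear_op T'"
proof -
  have "T' o\<^sub>L scaleC_op c = scaleC_op c o\<^sub>L T'" for c
    using has_adj_unique[OF has_adj_compose[OF assms(1) has_adj_scaleC[of "cnj c"]]]
      has_adj_compose[OF has_adj_scaleC[of "cnj c"] assms(1)] scaleC_op_commute[OF assms(2)]
    by (metis complex_cnj_cnj)
  then have "(T' o\<^sub>L scaleC_op c) x = (scaleC_op c o\<^sub>L T') x" for c x by simp
  then show ?thesis by (simp add: clinear_op_def scaleC_op.rep_eq)
qed

section \<open>Norm closedness of the algebra\<close>

lemma tendsto_blinfun_zero:
  fixes T :: "'a::real_normed_vector \<Rightarrow>\<^sub>L 'b::real_normed_vector"
  assumes "(\<lambda>n. x n) \<longlonglongrightarrow> 0" shows "(\<lambda>n. T (x n)) \<longlonglongrightarrow> 0"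
  using blinfun.tendsto[OF tendsto_const assms, of T] by simp

text \<open>The vectors have norm one, so a norm approximation of \<open>F\<close> is uniform in
  \<open>n\<close> on them.\<close>

lemma vanishing_limit:
  fixes f :: "nat \<Rightarrow> 'i ell2 \<Rightarrow>\<^sub>L 'i ell2"
  assumes lim: "f \<longlonglongrightarrow> F" and f: "\<And>k. (\<lambda>n. f k (unit_ell2 (u n))) \<longlonglongrightarrow> 0"
  shows "(\<lambda>n. F (unit_ell2 (u n))) \<longlonglongrightarrow> 0"
proof (rule LIMSEQ_I)
  fix e :: real assume "0 < e"
  then obtain k where k: "norm (f k - F) < e/2"
    using LIMSEQ_D[OF lim, of "e/2"] by auto
  obtain N where N: "\<And>n. n \<ge> N \<Longrightarrow> norm (f k (unit_ell2 (u n))) < e/2"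
    using LIMSEQ_D[OF f[of k], of "e/2"] \<open>0 < e\<close> by auto
  have "norm (F (unit_ell2 (u n))) < e" if "n \<ge> N" for n
  proof -
    let ?d = "unit_ell2 (u n)"
    have "norm (F ?d) = norm (f k ?d - (f k - F) ?d)" by (simp add: blinfun.diff_left)
    also have "\<dots> \<le> norm (f k ?d) + norm ((f k - F) ?d)" by (rule norm_triangle_ineq4)
    also have "\<dots> \<le> norm (f k ?d) + norm (f k - F)"
      using norm_blinfun[of "f k - F" ?d] by simp
    also have "\<dots> < e" using N[OF that] k by simp
    finally show ?thesis .
  qed
  then show "\<exists>N. \<forall>n\<ge>N. norm (F (unit_ell2 (u n)) - 0) < e" by auto
qed

lemma has_adj_diff: "has_adj T S \<Longrightarrow> has_adj T' S' \<Longrightarrow> has_adj (T - T') (S - S')"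
  by (simp add: has_adj_def blinfun.diff_left inner_diff_left inner_diff_right)

text \<open>Taking adjoints is isometric, so the adjoints of a convergent sequence converge too, and
  their limit is the adjoint of the limit. The other conditions pass to limits pointwise or by
  \<open>vanishing_limit\<close>.\<close>

lemma closed_block_ops: "closed block_ops"
  unfolding closed_sequential_limits
proof (intro allI impI)
  fix f F assume "(\<forall>k. f k \<in> block_ops) \<and> f \<longlonglongrightarrow> F"
  then have f: "\<And>k. f k \<in> block_ops" and lim: "f \<longlonglongrightarrow> F" by auto
  note D = block_opsD[OF f]
  have "norm (adj_op (f k) - adj_op (f l)) = norm (f k - f l)" for k l
    by (intro norm_adj has_adj_diff D)
  then have "Cauchy (\<lambda>k. adj_op (f k))"
    using LIMSEQ_imp_Cauchy[OF lim] by (simp add: Cauchy_def dist_norm)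
  then obtain G where G: "(\<lambda>k. adj_op (f k)) \<longlonglongrightarrow> G"
    using Cauchy_convergent_iff convergent_def by blast
  have ptw: "(\<lambda>k. f k x) \<longlonglongrightarrow> F x" "(\<lambda>k. adj_op (f k) x) \<longlonglongrightarrow> G x" for x
    using blinfun.tendsto[OF lim tendsto_const] blinfun.tendsto[OF G tendsto_const] by auto
  show "F \<in> block_ops"
  proof (rule block_opsI)
    show "has_adj F G"
      unfolding has_adj_def
    proof (intro allI)
      fix x y
      have "(\<lambda>k. inner (f k x) y) \<longlonglongrightarrow> inner (F x) y"
        "(\<lambda>k. inner x (adj_op (f k) y)) \<longlonglongrightarrow> inner x (G y)"
        by (intro tendsto_intros ptw)+
      moreover have "inner (f k x) y = inner x (adj_op (f k) y)" for k
        using D(2)[of k] by (simp add: has_adj_def)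
      ultimately show "inner (F x) y = inner x (G y)" by (simp add: LIMSEQ_unique)
    qed
    \<comment> \<open>Used with \<open>B\<close> a scalar for complex linearity and with
      \<open>B\<close> a block projection for block diagonality.\<close>
    have commute: "F (B x) = B (F x)" if "\<And>k. f k (B x) = B (f k x)"
      for B :: "ix ell2 \<Rightarrow>\<^sub>L ix ell2" and x
    proof (rule LIMSEQ_unique)
      show "(\<lambda>k. f k (B x)) \<longlonglongrightarrow> F (B x)" by (rule ptw)
      show "(\<lambda>k. f k (B x)) \<longlonglongrightarrow> B (F x)"
        unfolding that by (intro blinfun.tendsto tendsto_const ptw)
    qed
    show "clinear_op F"
      unfolding clinear_op_def
    proof (intro allI)
      show "F (scaleC_ell2 c x) = scaleC_ell2 c (F x)" for c x
        using commute[of "scaleC_op c" x] D(1) by (simp add: scaleC_op.rep_eq clinear_op_def)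
    qed
    show "F o\<^sub>L block n = block n o\<^sub>L F" for n
    proof (rule blinfun_eqI)
      fix x
      have "f k (block n x) = block n (f k x)" for k
        using D(3)[of k n] by (metis blinfun_apply_blinfun_compose)
      then show "(F o\<^sub>L block n) x = (block n o\<^sub>L F) x" using commute[of "block n" x] by simp
    qed
    show "(\<lambda>n. F (unit0 n)) \<longlonglongrightarrow> 0" by (rule vanishing_limit[OF lim D(4)])
    show "(\<lambda>n. G (unit0 n)) \<longlonglongrightarrow> 0" by (rule vanishing_limit[OF G D(5)])
  qed
qed

text \<open>The coordinates of \<open>\<ell>\<^sup>2(\<nat> \<times> \<nat>)\<close> are transported to \<open>\<nat>\<close> by the library's pairing function.\<close>

definition op_code :: "(ix ell2 \<Rightarrow>\<^sub>L ix ell2) \<Rightarrow> (nat \<Rightarrow> complex) \<Rightarrow> nat \<Rightarrow> complex" where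
  "op_code T = (\<lambda>x. Rep_ell2 (T (Abs_ell2 (x \<circ> prod_encode))) \<circ> prod_decode)"

text \<open>Every vector arises from a recoded sequence, so the values of the code on square
  summable sequences already determine the operator.\<close>

lemma inj_op_code: "inj op_code"
proof (rule injI)
  fix T T' assume eq: "op_code T = op_code T'"
  show "T = T'"
  proof (rule blinfun_eqI, rule ell2_eqI)
    fix v :: "ix ell2" and i
    have "op_code T (Rep_ell2 v \<circ> prod_decode) (prod_encode i) =
        op_code T' (Rep_ell2 v \<circ> prod_decode) (prod_encode i)"
      by (simp add: eq)
    then show "Rep_ell2 (T v) i = Rep_ell2 (T' v) i"
      by (simp add: op_code_def comp_def Rep_ell2_inverse)
  qed
qed

interpretation A: operator_algebra op_code block_ops
proof
  show "inj op_code" by (rule inj_op_code)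
  show "closed block_ops" by (rule closed_block_ops)
  show "0 \<in> block_ops"
    by (rule block_opsI[OF _ has_adj_zero])
      (auto simp: clinear_op_def intro!: blinfun_eqI ell2_eqI simp: scaleC_ell2.rep_eq zero_ell2.rep_eq)
next
  fix f g assume fg: "f \<in> block_ops" "g \<in> block_ops"
  note f = block_opsD[OF fg(1)] and g = block_opsD[OF fg(2)]
  show "f + g \<in> block_ops"
  proof (rule block_opsI[OF _ has_adj_add[OF f(2) g(2)]])
    show "clinear_op (f + g)" using f(1) g(1) by (simp add: clinear_op_def blinfun.add_left)
    show "(f + g) o\<^sub>L block n = block n o\<^sub>L (f + g)" for n
      using f(3) g(3) by (simp add: bounded_bilinear.add_left[OF bounded_bilinear_blinfun_compose]
        bounded_bilinear.add_right[OF bounded_bilinear_blinfun_compose])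
    show "(\<lambda>n. (f + g) (unit0 n)) \<longlonglongrightarrow> 0" "(\<lambda>n. (adj_op f + adj_op g) (unit0 n)) \<longlonglongrightarrow> 0"
      using tendsto_add[OF f(4) g(4)] tendsto_add[OF f(5) g(5)] by (simp_all add: blinfun.add_left)
  qed
  show "f o\<^sub>L g \<in> block_ops"
  proof (rule block_opsI[OF _ has_adj_compose[OF f(2) g(2)]])
    show "clinear_op (f o\<^sub>L g)" using f(1) g(1) by (simp add: clinear_op_def)
    show "(f o\<^sub>L g) o\<^sub>L block n = block n o\<^sub>L (f o\<^sub>L g)" for n
      using f(3) g(3) by (metis blinfun_compose_assoc)
    \<comment> \<open>The factor applied first produces the null sequence: \<open>g\<close> in the
      product, \<open>adj_op f\<close> in its adjoint.\<close>
    show "(\<lambda>n. (f o\<^sub>L g) (unit0 n)) \<longlonglongrightarrow> 0" "(\<lambda>n. (adj_op g o\<^sub>L adj_op f) (unit0 n)) \<longlonglongrightarrow> 0"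
      using tendsto_blinfun_zero[OF g(4)] tendsto_blinfun_zero[OF f(5)] by simp_all
  qed
next
  fix f c assume "f \<in> block_ops"
  note f = block_opsD[OF this]
  show "clinear_op f" by (rule f)
  show "scaleC_op c o\<^sub>L f \<in> block_ops"
  proof (rule block_opsI[OF _ has_adj_compose[OF has_adj_scaleC f(2)]])
    show "clinear_op (scaleC_op c o\<^sub>L f)"
      using f(1) by (simp add: clinear_op_def scaleC_op.rep_eq mult.commute)
    have "scaleC_op c o\<^sub>L block n = block n o\<^sub>L scaleC_op c" for n
      by (rule scaleC_op_commute[symmetric])
        (simp add: block_def clinear_mult_op[OF bounded_range_bool])
    then show "(scaleC_op c o\<^sub>L f) o\<^sub>L block n = block n o\<^sub>L (scaleC_op c o\<^sub>L f)" for n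
      using f(3) by (metis blinfun_compose_assoc)
    show "(\<lambda>n. (scaleC_op c o\<^sub>L f) (unit0 n)) \<longlonglongrightarrow> 0"
      using tendsto_blinfun_zero[OF f(4)] by simp
    show "(\<lambda>n. (adj_op f o\<^sub>L scaleC_op (cnj c)) (unit0 n)) \<longlonglongrightarrow> 0"
      unfolding scaleC_op_commute[OF clinear_adj[OF f(2,1)]]
      using tendsto_blinfun_zero[OF f(5)] by simp
  qed
  show "\<exists>g\<in>block_ops. has_adj f g"
  proof
    show "has_adj f (adj_op f)" by (rule f)
    show "adj_op f \<in> block_ops"
      by (rule block_opsI[OF _ has_adj_sym[OF f(2)]])
        (use f clinear_adj[OF f(2,1)] block_adj_commute[OF f(2) f(3)] in auto)
  qed
qed


section \<open>Strict positivity\<close>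

text \<open>The degenerate case of the Cauchy-Schwarz inequality. Positivity on
  \<open>f + c g\<close> loses its quadratic term in \<open>c\<close>, and an affine function of
  \<open>c\<close> that is never negative must be constant.\<close>

lemma (in operator_algebra) positive_functional_null:
  assumes \<phi>: "positive_functional alg \<phi>" and S: "f \<in> S" "g \<in> S"
    and null: "\<phi> (emb (adj_op g o\<^sub>L g)) = 0"
  shows "\<phi> (emb (adj_op g o\<^sub>L f)) = 0" "\<phi> (emb (adj_op f o\<^sub>L g)) = 0"
proof -
  have add: "\<phi> (emb (a + b)) = \<phi> (emb a) + \<phi> (emb b)" if "a \<in> S" "b \<in> S" for a b
  proof -
    have "\<phi> (emb a \<oplus>\<^bsub>alg\<^esub> emb b) = \<phi> (emb a) + \<phi> (emb b)"
      using \<phi> that unfolding positive_functional_def linear_functional_def by (meson emb_mem_iff)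
    then show ?thesis by simp
  qed
  have scale: "\<phi> (emb (scaleC_op c o\<^sub>L a)) = c * \<phi> (emb a)" if "a \<in> S" for a c
  proof -
    have "\<phi> (c \<odot>\<^bsub>alg\<^esub> emb a) = c * \<phi> (emb a)"
      using \<phi> that unfolding positive_functional_def linear_functional_def by (meson emb_mem_iff)
    then show ?thesis by simp
  qed
  have pos: "Im (\<phi> (emb (adj_op k o\<^sub>L k))) = 0 \<and> 0 \<le> Re (\<phi> (emb (adj_op k o\<^sub>L k)))" if "k \<in> S" for k
  proof -
    have "positive_element alg (emb (adj_op k o\<^sub>L k))"
      unfolding positive_element_def using that by (intro bexI[of _ "emb k"]) auto
    then show ?thesis using \<phi> unfolding positive_functional_def by blast
  qed
  define P \<alpha> \<beta> where "P = \<phi> (emb (adj_op f o\<^sub>L f))" and "\<alpha> = \<phi> (emb (adj_op f o\<^sub>L g))"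
    and "\<beta> = \<phi> (emb (adj_op g o\<^sub>L f))"
  have quad: "Im (P + c * \<alpha> + cnj c * \<beta>) = 0 \<and> 0 \<le> Re (P + c * \<alpha> + cnj c * \<beta>)" for c
  proof -
    let ?k = "f + (scaleC_op c o\<^sub>L g)"
    have k: "?k \<in> S" by (intro add_mem scale_mem S)
    have mems: "adj_op f o\<^sub>L f \<in> S" "adj_op f o\<^sub>L g \<in> S" "adj_op g o\<^sub>L f \<in> S" "adj_op g o\<^sub>L g \<in> S"
      by (intro compose_mem adj_mem S)+
    have "has_adj ?k (adj_op f + (adj_op g o\<^sub>L scaleC_op (cnj c)))"
      by (intro has_adj_add has_adj_compose has_adj_scaleC has_adj_adj_op S)
    then have adj_k: "adj_op ?k = adj_op f + (scaleC_op (cnj c) o\<^sub>L adj_op g)"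
      by (simp add: adj_op_eq scaleC_op_commute clinear adj_mem S)
    have "adj_op ?k o\<^sub>L ?k = (adj_op f o\<^sub>L f) + (scaleC_op c o\<^sub>L (adj_op f o\<^sub>L g)) +
        (scaleC_op (cnj c) o\<^sub>L (adj_op g o\<^sub>L f)) +
        (scaleC_op (cnj c * c) o\<^sub>L (adj_op g o\<^sub>L g))"
    proof (rule blinfun_eqI)
      have "adj_op f (scaleC_ell2 c x) = scaleC_ell2 c (adj_op f x)"
        "adj_op g (scaleC_ell2 c x) = scaleC_ell2 c (adj_op g x)" for c x
        using clinear adj_mem S by (auto simp: clinear_op_def)
      then show "(adj_op ?k o\<^sub>L ?k) x = ((adj_op f o\<^sub>L f) + (scaleC_op c o\<^sub>L (adj_op f o\<^sub>L g)) +
          (scaleC_op (cnj c) o\<^sub>L (adj_op g o\<^sub>L f)) +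
          (scaleC_op (cnj c * c) o\<^sub>L (adj_op g o\<^sub>L g))) x" for x
        unfolding adj_k
        by (simp add: blinfun.add_left blinfun.add_right scaleC_op.rep_eq add.assoc add.commute add.left_commute)
    qed
    then have "\<phi> (emb (adj_op ?k o\<^sub>L ?k)) = P + c * \<alpha> + cnj c * \<beta>"
      by (simp add: add scale add_mem scale_mem mems null P_def \<alpha>_def \<beta>_def)
    with pos[OF k] show ?thesis by simp
  qed
  have ImP: "Im P = 0" using quad[of 0] by simp
  \<comment> \<open>The values at \<open>c = 1\<close> and \<open>c = \<i>\<close> are real, which
    forces \<open>\<beta>\<close> to be the conjugate of \<open>\<alpha>\<close>.\<close>
  have "Im \<beta> = - Im \<alpha>" "Re \<beta> = Re \<alpha>"
    using quad[of 1] quad[of \<i>] ImP by simp_all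
  then have \<beta>: "\<beta> = cnj \<alpha>" by (simp add: complex_eq_iff)
  have "\<alpha> = 0"
  proof (rule ccontr)
    assume "\<alpha> \<noteq> 0"
    \<comment> \<open>With this \<open>t\<close>, the choice \<open>c = - t * cnj \<alpha>\<close>
      makes the expression equal to -1.\<close>
    define t where "t = (Re P + 1) / (2 * (cmod \<alpha>)\<^sup>2)"
    have "0 \<le> Re P - 2 * t * (cmod \<alpha>)\<^sup>2"
      using quad[of "- of_real t * cnj \<alpha>"] unfolding \<beta> cmod_power2
      by (simp add: power2_eq_square algebra_simps)
    moreover have "2 * t * (cmod \<alpha>)\<^sup>2 = Re P + 1"
      using \<open>\<alpha> \<noteq> 0\<close> by (simp add: t_def)
    ultimately show False by simp
  qed
  then show "\<phi> (emb (adj_op g o\<^sub>L f)) = 0" "\<phi> (emb (adj_op f o\<^sub>L g)) = 0"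
    using \<beta> by (simp_all add: \<alpha>_def \<beta>_def)
qed

section \<open>Diagonal elements of the algebra\<close>

lemma mult_op_unit:
  assumes "bounded (range a)" shows "mult_op a (unit_ell2 k) = scaleC_ell2 (a k) (unit_ell2 k)"
  using assms by (auto intro!: ell2_eqI simp: Rep_mult_op unit_ell2.rep_eq scaleC_ell2.rep_eq)

lemma mult_op_block_ops:
  assumes b: "bounded (range a)" and v: "(\<lambda>n. a (n, 0)) \<longlonglongrightarrow> 0"
  shows "mult_op a \<in> block_ops"
proof -
  have b': "bounded (range (\<lambda>i. cnj (a i)))" using b by (auto simp: bounded_iff)
  have lim: "(\<lambda>n. mult_op c (unit0 n)) \<longlonglongrightarrow> 0" if "bounded (range c)" "(\<lambda>n. c (n, 0)) \<longlonglongrightarrow> 0" for c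
    by (rule tendsto_norm_zero_cancel)
      (use tendsto_norm_zero[OF that(2)] in \<open>simp add: mult_op_unit[OF that(1)] norm_scaleC\<close>)
  show ?thesis
  proof (rule block_opsI[OF clinear_mult_op[OF b] has_adj_mult_op[OF b]])
    show "mult_op a o\<^sub>L block n = block n o\<^sub>L mult_op a" for n
      unfolding block_def mult_op_mult[OF b bounded_range_bool] mult_op_mult[OF bounded_range_bool b]
      by (simp add: mult.commute)
    show "(\<lambda>n. mult_op a (unit0 n)) \<longlonglongrightarrow> 0" by (rule lim[OF b v])
    show "(\<lambda>n. mult_op (\<lambda>i. cnj (a i)) (unit0 n)) \<longlonglongrightarrow> 0"
      using tendsto_cnj[OF v] by (intro lim[OF b']) simp
  qed
qed

text \<open>Through \<open>mult_op\<close>, the three weights give the projection \<open>q\<close>,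
  the part of \<open>h\<close> on the base vectors, and \<open>h\<close> itself. The last is the sum
  of the first two.\<close>

definition off_diag :: "ix \<Rightarrow> complex" where "off_diag = (\<lambda>(n, m). if m = 0 then 0 else 1)"

definition base_weight :: "ix \<Rightarrow> complex" where
  "base_weight = (\<lambda>(n, m). if m = 0 then of_real (1 / real (Suc n)) else 0)"

definition strict_weight :: "ix \<Rightarrow> complex" where
  "strict_weight = (\<lambda>(n, m). if m = 0 then of_real (1 / real (Suc n)) else 1)"

lemma bounded_weights:
  "bounded (range off_diag)" "bounded (range base_weight)" "bounded (range strict_weight)"
proof -
  have "cmod (off_diag i) \<le> 1 \<and> cmod (base_weight i) \<le> 1 \<and> cmod (strict_weight i) \<le> 1" for i
    by (cases i) (auto simp: off_diag_def base_weight_def strict_weight_def norm_divide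
        simp del: of_nat_Suc of_real_divide)
  then show "bounded (range off_diag)" "bounded (range base_weight)" "bounded (range strict_weight)"
    by (auto simp: bounded_iff)
qed

lemma Rep_off_diag: "Rep_ell2 (mult_op off_diag x) i = (if snd i = 0 then 0 else Rep_ell2 x i)"
  by (subst Rep_mult_op[OF bounded_weights(1)]) (simp add: off_diag_def case_prod_unfold)

lemma weights_mem:
  "mult_op off_diag \<in> block_ops" "mult_op base_weight \<in> block_ops" "mult_op strict_weight \<in> block_ops"
proof -
  have "(\<lambda>n. complex_of_real (1 / real (Suc n))) \<longlonglongrightarrow> 0"
    using tendsto_of_real[OF LIMSEQ_Suc[OF lim_inverse_n'], where 'a = complex] by simp
  then show "mult_op off_diag \<in> block_ops" "mult_op base_weight \<in> block_ops"
      "mult_op strict_weight \<in> block_ops"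
    by (intro mult_op_block_ops bounded_weights; simp add: off_diag_def base_weight_def strict_weight_def)+
qed

lemma adj_op_mult_op: "bounded (range a) \<Longrightarrow> adj_op (mult_op a) = mult_op (\<lambda>i. cnj (a i))"
  by (intro adj_op_eq has_adj_mult_op)

text \<open>Square roots keep a weight bounded and vanishing at the base vectors, so positive
  diagonal elements have diagonal square roots inside the algebra.\<close>

lemma mult_op_nonneg_square:
  fixes r :: "ix \<Rightarrow> real"
  assumes r: "\<And>i. 0 \<le> r i" "bounded (range r)" "(\<lambda>n. r (n, 0)) \<longlonglongrightarrow> 0"
  defines "s \<equiv> \<lambda>i. complex_of_real (sqrt (r i))"
  shows "bounded (range s)" "(\<lambda>n. s (n, 0)) \<longlonglongrightarrow> 0" "mult_op s \<in> block_ops"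
    "mult_op (\<lambda>i. of_real (r i)) = adj_op (mult_op s) o\<^sub>L mult_op s"
proof -
  obtain C where "\<And>i. \<bar>r i\<bar> \<le> C" using r(2) by (auto simp: bounded_iff)
  then show b: "bounded (range s)"
    using r(1) by (auto simp: s_def bounded_iff intro!: exI[of _ "sqrt C"])
  show v: "(\<lambda>n. s (n, 0)) \<longlonglongrightarrow> 0"
    using tendsto_of_real[OF tendsto_real_sqrt[OF r(3)], where 'a = complex] by (simp add: s_def)
  show "mult_op s \<in> block_ops" by (rule mult_op_block_ops[OF b v])
  have b': "bounded (range (\<lambda>i. cnj (s i)))" using b by (auto simp: bounded_iff)
  have "cnj (s i) * s i = of_real (r i)" for i
    using r(1)[of i] by (simp add: s_def flip: of_real_mult)
  then show "mult_op (\<lambda>i. of_real (r i)) = adj_op (mult_op s) o\<^sub>L mult_op s"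
    by (simp add: adj_op_mult_op b mult_op_mult b b')
qed

lemma mult_op_positive_element:
  fixes r :: "ix \<Rightarrow> real"
  assumes "\<And>i. 0 \<le> r i" "bounded (range r)" "(\<lambda>n. r (n, 0)) \<longlonglongrightarrow> 0"
  shows "positive_element A.alg (op_code (mult_op (\<lambda>i. of_real (r i))))"
  using mult_op_nonneg_square[OF assms] unfolding positive_element_def
  by (intro bexI[of _ "op_code (mult_op (\<lambda>i. complex_of_real (sqrt (r i))))"]) simp_all

lemma strict_weight_eq:
  "strict_weight = (\<lambda>(n, m). of_real (if m = 0 then 1 / real (Suc n) else 1))"
  by (auto simp: strict_weight_def fun_eq_iff)

text \<open>This is the expansion of \<open>(1 - q) T (1 - q)\<close>, arranged so that every
  summand lies in the algebra although \<open>1 - q\<close> does not. The compression is diagonal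
  because each block contains a single base vector; its entries tend to 0 with
  \<open>T (unit0 n)\<close>.\<close>

lemma base_entry_decomposition:
  assumes T: "T \<in> block_ops"
  defines "entries \<equiv> \<lambda>(n, m::nat). if m = 0 then Rep_ell2 (T (unit0 n)) (n, 0) else (0::complex)"
  shows "bounded (range entries)" "(\<lambda>n. entries (n, 0)) \<longlonglongrightarrow> 0"
    "T + (mult_op off_diag o\<^sub>L (T o\<^sub>L mult_op off_diag)) =
      (mult_op off_diag o\<^sub>L T) + (T o\<^sub>L mult_op off_diag) + mult_op entries"
proof -
  note D = block_opsD[OF T]
  have entry: "cmod (Rep_ell2 (T (unit0 n)) (n, 0)) \<le> norm (T (unit0 n))" for n
    by (rule cmod_Rep_ell2_le)
  have "cmod (entries i) \<le> norm T" for i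
  proof (cases i)
    case (Pair n m)
    then show ?thesis
      using order_trans[OF entry[of n] norm_blinfun[of T "unit0 n"]] by (simp add: entries_def)
  qed
  then show b: "bounded (range entries)" by (auto simp: bounded_iff)
  show "(\<lambda>n. entries (n, 0)) \<longlonglongrightarrow> 0"
    by (rule Lim_null_comparison[OF _ tendsto_norm_zero[OF D(4)]]) (simp add: entries_def entry)
  show "T + (mult_op off_diag o\<^sub>L (T o\<^sub>L mult_op off_diag)) =
      (mult_op off_diag o\<^sub>L T) + (T o\<^sub>L mult_op off_diag) + mult_op entries"
  proof (rule blinfun_eqI, rule ell2_eqI)
    fix x :: "ix ell2" and i :: ix
    obtain n m where i: "i = (n, m)" by (cases i)
    \<comment> \<open>This is \<open>(1 - q) x\<close>, whose component in block \<open>n\<close> is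
      a multiple of \<open>unit0 n\<close>.\<close>
    let ?y = "x - mult_op off_diag x"
    have "block n ?y = scaleC_ell2 (Rep_ell2 x (n, 0)) (unit0 n)"
      by (rule ell2_eqI) (auto simp: Rep_block minus_ell2.rep_eq Rep_off_diag
          scaleC_ell2.rep_eq unit_ell2.rep_eq)
    then have "block n (T ?y) = scaleC_ell2 (Rep_ell2 x (n, 0)) (T (unit0 n))"
      using D(1) D(3)[of n] by (metis blinfun_apply_blinfun_compose clinear_op_def)
    from arg_cong[OF this, of "\<lambda>v. Rep_ell2 v (n, 0)"]
    have "Rep_ell2 (T x) (n, 0) =
        Rep_ell2 (T (mult_op off_diag x)) (n, 0) + Rep_ell2 (T (unit0 n)) (n, 0) * Rep_ell2 x (n, 0)"
      by (simp add: Rep_block scaleC_ell2.rep_eq blinfun.diff_right minus_ell2.rep_eq algebra_simps)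
    then show "Rep_ell2 ((T + (mult_op off_diag o\<^sub>L (T o\<^sub>L mult_op off_diag))) x) i =
        Rep_ell2 (((mult_op off_diag o\<^sub>L T) + (T o\<^sub>L mult_op off_diag) + mult_op entries) x) i"
      unfolding i
      by (simp add: blinfun.add_left plus_ell2.rep_eq Rep_off_diag Rep_mult_op[OF b])
        (simp add: entries_def)
  qed
qed

section \<open>Positive functionals on the strictly positive element\<close>

lemma nonpos_if_le_all_multiples:
  fixes a b :: real
  assumes "\<And>e. 0 < e \<Longrightarrow> a \<le> e * b" shows "a \<le> 0"
proof (rule ccontr)
  assume a: "\<not> a \<le> 0"
  then have "0 < b" using assms[of 1] by simp
  with a assms[of "a / (2 * b)"] show False by (simp add: field_simps)
qed

text \<open>If a positive functional is not positive on \<open>h\<close>, it vanishes on both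
  positive summands of \<open>h\<close>. Vanishing on \<open>q\<close> annihilates all
  \<open>q T\<close> and \<open>T q\<close> by Cauchy-Schwarz, vanishing on the base part
  annihilates the diagonal compressions, and the decomposition of \<open>T\<close> leaves the zero
  functional.\<close>

lemma strictly_positive_strict_weight: "strictly_positive A.alg (op_code (mult_op strict_weight))"
  unfolding strictly_positive_def
proof (intro conjI allI impI)
  let ?M = "mult_op :: _ \<Rightarrow> ix ell2 \<Rightarrow>\<^sub>L ix ell2"
  have "(\<lambda>n. 1 / real (Suc n)) \<longlonglongrightarrow> 0"
    using LIMSEQ_Suc[OF lim_inverse_n'] by simp
  then have base_lim: "(\<lambda>n. (case (n, 0::nat) of (n, m) \<Rightarrow> if m = 0 then 1 / real (Suc n) else c)) \<longlonglongrightarrow> 0"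
    for c by simp
  have base_bd: "bounded (range (\<lambda>(n, m::nat). if m = 0 then 1 / real (Suc n) else 1))"
    by (auto simp: bounded_iff intro!: exI[of _ 1])
  show "positive_element A.alg (op_code (?M strict_weight))"
    using mult_op_positive_element[OF _ base_bd base_lim]
    by (simp add: strict_weight_eq case_prod_unfold)
  fix \<phi> assume *: "positive_functional A.alg \<phi> \<and> (\<exists>x\<in>carrier A.alg. \<phi> x \<noteq> 0)"
  then have \<phi>: "positive_functional A.alg \<phi>" by blast
  define \<psi> where "\<psi> T = \<phi> (op_code T)" for T
  have add: "\<psi> (a + b) = \<psi> a + \<psi> b" if "a \<in> block_ops" "b \<in> block_ops" for a b
  proof -
    have "\<phi> (op_code a \<oplus>\<^bsub>A.alg\<^esub> op_code b) = \<phi> (op_code a) + \<phi> (op_code b)"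
      using \<phi> that unfolding positive_functional_def linear_functional_def by (meson A.emb_mem_iff)
    then show ?thesis by (simp add: \<psi>_def)
  qed
  have scale: "\<psi> (scaleC_op c o\<^sub>L a) = c * \<psi> a" if "a \<in> block_ops" for a c
  proof -
    have "\<phi> (c \<odot>\<^bsub>A.alg\<^esub> op_code a) = c * \<phi> (op_code a)"
      using \<phi> that unfolding positive_functional_def linear_functional_def by (meson A.emb_mem_iff)
    then show ?thesis by (simp add: \<psi>_def)
  qed
  have pos: "Im (\<psi> (?M (\<lambda>i. of_real (r i)))) = 0 \<and> 0 \<le> Re (\<psi> (?M (\<lambda>i. of_real (r i))))"
    if "\<And>i. 0 \<le> r i" "bounded (range r)" "(\<lambda>n. r (n, 0)) \<longlonglongrightarrow> 0" for r :: "ix \<Rightarrow> real"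
    using \<phi> mult_op_positive_element[OF that] unfolding positive_functional_def \<psi>_def by blast
  show "0 < Re (\<phi> (op_code (?M strict_weight)))"
  proof (rule ccontr)
    assume neg: "\<not> 0 < Re (\<phi> (op_code (?M strict_weight)))"
    have weight_sum: "strict_weight = (\<lambda>i. base_weight i + off_diag i)"
      by (auto simp: strict_weight_def base_weight_def off_diag_def)
    have "?M strict_weight = ?M base_weight + ?M off_diag"
      unfolding weight_sum by (rule mult_op_add[OF bounded_weights(2,1)])
    then have sum_le: "Re (\<psi> (?M base_weight)) + Re (\<psi> (?M off_diag)) \<le> 0"
      using neg by (simp add: add weights_mem flip: \<psi>_def)
    have base_eq: "base_weight = (\<lambda>i. of_real (case i of (n, m) \<Rightarrow> if m = 0 then 1 / real (Suc n) else 0))"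
      by (auto simp: base_weight_def)
    have off_eq: "off_diag = (\<lambda>i. of_real (case i of (n, m) \<Rightarrow> if m = 0 then 0 else 1))"
      by (auto simp: off_diag_def)
    have "bounded (range (\<lambda>(n, m::nat). if m = 0 then 1 / real (Suc n) else 0))"
      by (auto simp: bounded_iff intro!: exI[of _ 1])
    from pos[OF _ this base_lim] have base_pos: "Im (\<psi> (?M base_weight)) = 0 \<and> 0 \<le> Re (\<psi> (?M base_weight))"
      unfolding base_eq by (auto simp: case_prod_unfold)
    have off_pos: "Im (\<psi> (?M off_diag)) = 0 \<and> 0 \<le> Re (\<psi> (?M off_diag))"
      unfolding off_eq by (intro pos) (auto simp: bounded_iff intro!: exI[of _ 1])
    have \<psi>_base: "\<psi> (?M base_weight) = 0" and \<psi>_off: "\<psi> (?M off_diag) = 0"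
      using sum_le base_pos off_pos by (auto simp: complex_eq_iff)
    have "(\<lambda>i. cnj (off_diag i)) = off_diag" by (auto simp: off_diag_def)
    then have adj_off: "adj_op (?M off_diag) = ?M off_diag"
      using adj_op_mult_op[OF bounded_weights(1)] by simp
    have off_sq: "adj_op (?M off_diag) o\<^sub>L ?M off_diag = ?M off_diag"
      unfolding adj_off by (intro blinfun_eqI ell2_eqI) (simp add: Rep_off_diag)
    have off_sq_null: "\<phi> (op_code (adj_op (?M off_diag) o\<^sub>L ?M off_diag)) = 0"
      using \<psi>_off by (simp only: off_sq \<psi>_def)
    have off_null: "\<psi> (?M off_diag o\<^sub>L T) = 0" "\<psi> (T o\<^sub>L ?M off_diag) = 0" if T: "T \<in> block_ops" for T
    proof -
      have adj_adj: "adj_op (adj_op T) = T" by (rule adj_op_eq[OF has_adj_sym[OF block_opsD(2)[OF T]]])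
      show "\<psi> (?M off_diag o\<^sub>L T) = 0"
        using A.positive_functional_null(1)[OF \<phi> T weights_mem(1) off_sq_null]
        by (simp only: adj_off \<psi>_def)
      \<comment> \<open>The second half of \<open>positive_functional_null\<close> is applied to the
        adjoint of \<open>T\<close>, whose adjoint is \<open>T\<close> again.\<close>
      show "\<psi> (T o\<^sub>L ?M off_diag) = 0"
        using A.positive_functional_null(2)[OF \<phi> A.adj_mem[OF T] weights_mem(1) off_sq_null]
        by (simp only: adj_adj \<psi>_def)
    qed
    have base_null: "\<psi> (?M (\<lambda>i. of_real (r i))) = 0"
      if r: "\<And>i. 0 \<le> r i" "bounded (range r)" "(\<lambda>n. r (n, 0)) \<longlonglongrightarrow> 0" "\<And>n m. m \<noteq> 0 \<Longrightarrow> r (n, m) = 0"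
      for r :: "ix \<Rightarrow> real"
    proof -
      let ?s = "\<lambda>i. complex_of_real (sqrt (r i))"
      note sq = mult_op_nonneg_square[OF r(1-3)]
      have s_real: "bounded (range (\<lambda>i. sqrt (r i)))" "(\<lambda>n. sqrt (r (n, 0))) \<longlonglongrightarrow> 0"
        using sq(1) tendsto_real_sqrt[OF r(3)] by (auto simp: bounded_iff)
      have r_mem: "?M (\<lambda>i. of_real (r i)) \<in> block_ops"
        unfolding sq(4) using sq(3) by (intro A.compose_mem A.adj_mem)
      obtain B where B: "\<And>i. r i \<le> B" using r(1,2) by (auto simp: bounded_iff)
      \<comment> \<open>\<open>r \<le> K base_weight + e \<surd>r\<close> for a suitable \<open>K\<close>; this replaces continuity of \<open>\<phi>\<close>.\<close>
      have "Re (\<psi> (?M (\<lambda>i. of_real (r i)))) \<le> e * Re (\<psi> (?M ?s))" if "0 < e" for e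
      proof -
        obtain N where N: "\<And>n. n \<ge> N \<Longrightarrow> sqrt (r (n, 0)) < e"
          using LIMSEQ_D[OF s_real(2) \<open>0 < e\<close>] r(1) by auto
        \<comment> \<open>For \<open>n < N\<close> this \<open>K\<close> makes the base weight term
          at least the bound \<open>B\<close>; from \<open>N\<close> on, the term with the square
          root suffices.\<close>
        define K where "K = B * real (Suc N)"
        have B0: "0 \<le> B" using B r(1) by (meson order_trans)
        \<comment> \<open>The slack in the inequality: a nonnegative weight vanishing at the base
          vectors, on which the functional is therefore nonnegative.\<close>
        define t where "t = (\<lambda>i. K * (case i of (n, m) \<Rightarrow> if m = 0 then 1 / real (Suc n) else 0)
            + e * sqrt (r i) - r i)"
        have r_le: "r (n, 0) \<le> K * (1 / real (Suc n)) + e * sqrt (r (n, 0))" for n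
        proof (cases "n \<ge> N")
          case True
          have "r (n, 0) = sqrt (r (n, 0)) * sqrt (r (n, 0))" using r(1) by simp
          also have "\<dots> \<le> e * sqrt (r (n, 0))"
            using N[OF True] r(1) by (intro mult_right_mono) auto
          also have "\<dots> \<le> K * (1 / real (Suc n)) + e * sqrt (r (n, 0))"
            using B0 by (simp add: K_def)
          finally show ?thesis .
        next
          case False
          have "r (n, 0) \<le> B * 1" using B by simp
          also have "\<dots> \<le> B * (real (Suc N) * (1 / real (Suc n)))"
            using False B0 by (intro mult_left_mono) (auto simp: field_simps)
          also have "\<dots> \<le> K * (1 / real (Suc n)) + e * sqrt (r (n, 0))"
            using \<open>0 < e\<close> r(1) by (simp add: K_def)
          finally show ?thesis .
        qed
        have t0: "0 \<le> t i" for i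
        proof (cases i)
          case (Pair n m)
          then show ?thesis using r_le[of n] r(4)[of m n] by (auto simp: t_def)
        qed
        have "bounded (range (\<lambda>i. case i of (n, m::nat) \<Rightarrow> if m = 0 then 1 / real (Suc n) else 0))"
          by (auto simp: bounded_iff intro!: exI[of _ 1])
        from bounded_scaleR_comp[OF this, of K] bounded_scaleR_comp[OF s_real(1), of e]
        have t_bd: "bounded (range t)"
          unfolding t_def by (intro bounded_minus_comp bounded_plus_comp r(2)) auto
        have t_lim: "(\<lambda>n. t (n, 0)) \<longlonglongrightarrow> 0"
        proof -
          have "(\<lambda>n. t (n, 0)) \<longlonglongrightarrow> K * 0 + e * 0 - 0"
            unfolding t_def by (intro tendsto_intros base_lim s_real(2) r(3))
          then show ?thesis by simp
        qed
        have t_mem: "?M (\<lambda>i. of_real (t i)) \<in> block_ops"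
          using mult_op_nonneg_square(3,4)[OF t0 t_bd t_lim] by (simp add: A.compose_mem A.adj_mem)
        have bds: "bounded (range (\<lambda>i. complex_of_real (r i)))" "bounded (range (\<lambda>i. complex_of_real (t i)))"
          "bounded (range (\<lambda>i. of_real K * base_weight i))" "bounded (range (\<lambda>i. of_real e * ?s i))"
          using r(2) t_bd bounded_range_mult[of "\<lambda>_. of_real K" base_weight]
            bounded_range_mult[of "\<lambda>_. of_real e" ?s] bounded_weights(2) sq(1)
          by (auto simp: bounded_iff)
        have "(\<lambda>i. of_real (r i) + complex_of_real (t i)) = (\<lambda>i. of_real K * base_weight i + of_real e * ?s i)"
          by (auto simp: t_def base_eq fun_eq_iff)
        then have sum_eq: "?M (\<lambda>i. of_real (r i)) + ?M (\<lambda>i. of_real (t i)) =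
            (scaleC_op (of_real K) o\<^sub>L ?M base_weight) + (scaleC_op (of_real e) o\<^sub>L ?M ?s)"
          using bds by (simp add: mult_op_scale bounded_weights sq(1) flip: mult_op_add)
        have "\<psi> (?M (\<lambda>i. of_real (r i))) + \<psi> (?M (\<lambda>i. of_real (t i))) =
            \<psi> ((scaleC_op (of_real K) o\<^sub>L ?M base_weight) + (scaleC_op (of_real e) o\<^sub>L ?M ?s))"
          unfolding sum_eq[symmetric] by (rule add[OF r_mem t_mem, symmetric])
        also have "\<dots> = of_real e * \<psi> (?M ?s)"
          by (simp add: add scale A.scale_mem weights_mem sq(3) \<psi>_base)
        finally have "\<psi> (?M (\<lambda>i. of_real (r i))) + \<psi> (?M (\<lambda>i. of_real (t i))) = of_real e * \<psi> (?M ?s)" .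
        from arg_cong[OF this, of Re] pos[OF t0 t_bd t_lim] show ?thesis by simp
      qed
      then have "Re (\<psi> (?M (\<lambda>i. of_real (r i)))) \<le> 0"
        by (rule nonpos_if_le_all_multiples)
      then show ?thesis using pos[OF r(1-3)] by (simp add: complex_eq_iff)
    qed
    have "\<psi> T = 0" if T: "T \<in> block_ops" for T
    proof -
      define c where "c = (\<lambda>(n, m::nat). if m = 0 then Rep_ell2 (T (unit0 n)) (n, 0) else (0::complex))"
      note dec = base_entry_decomposition[OF T, folded c_def]
      define r where "r i = cmod (c i)" for i
      have r: "\<And>i. 0 \<le> r i" "bounded (range r)" "(\<lambda>n. r (n, 0)) \<longlonglongrightarrow> 0" "\<And>n m. m \<noteq> 0 \<Longrightarrow> r (n, m) = 0"
      proof -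
        show "0 \<le> r i" for i by (simp add: r_def)
        show "bounded (range r)" using dec(1) by (simp add: r_def bounded_iff)
        show "(\<lambda>n. r (n, 0)) \<longlonglongrightarrow> 0" unfolding r_def by (rule tendsto_norm_zero[OF dec(2)])
        show "r (n, m) = 0" if "m \<noteq> 0" for n m using that by (simp add: r_def c_def)
      qed
      define s where "s = (\<lambda>i. complex_of_real (sqrt (r i)))"
      note sq = mult_op_nonneg_square[OF r(1-3), folded s_def]
      \<comment> \<open>The complex weight factors as \<open>c = s u\<close> with both moduli the
        square root of \<open>cmod c\<close>. Cauchy-Schwarz then reduces it to the nonnegative
        weight \<open>r\<close>. Where \<open>c\<close> is 0, division by zero gives
        \<open>u = 0\<close>, as needed.\<close>
      define u where "u = (\<lambda>i. c i / s i)"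
      have cu: "cmod (u i) = cmod (s i)" for i
        by (simp add: u_def s_def r_def norm_divide real_div_sqrt)
      have u: "bounded (range u)" "(\<lambda>n. u (n, 0)) \<longlonglongrightarrow> 0"
      proof -
        show "bounded (range u)" using sq(1) by (simp add: bounded_iff cu)
        show "(\<lambda>n. u (n, 0)) \<longlonglongrightarrow> 0"
        proof (rule tendsto_norm_zero_cancel)
          have "(\<lambda>n. s (n, 0)) \<longlonglongrightarrow> 0" using sq(2) by (simp add: s_def)
          from tendsto_norm_zero[OF this] show "(\<lambda>n. cmod (u (n, 0))) \<longlonglongrightarrow> 0" by (simp only: cu)
        qed
      qed
      have "cnj (s i) * u i = c i" for i by (simp add: u_def s_def r_def)
      then have c_eq: "?M c = adj_op (?M s) o\<^sub>L ?M u"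
        using has_adj_mult_op[OF sq(1)] sq(1) u(1)
        by (simp add: adj_op_mult_op mult_op_mult bounded_iff)
      have "\<phi> (op_code (adj_op (?M s) o\<^sub>L ?M s)) = 0"
        using base_null[OF r] by (simp add: \<psi>_def sq(4))
      then have c_null: "\<psi> (?M c) = 0"
        unfolding c_eq \<psi>_def
        by (intro A.positive_functional_null(1)[OF \<phi> mult_op_block_ops[OF u] sq(3)])
      have mems: "T o\<^sub>L ?M off_diag \<in> block_ops" "?M off_diag o\<^sub>L T \<in> block_ops"
        "?M off_diag o\<^sub>L (T o\<^sub>L ?M off_diag) \<in> block_ops" "?M c \<in> block_ops"
        using T weights_mem(1) dec(1,2) by (auto intro: A.compose_mem mult_op_block_ops)
      have "\<psi> T + \<psi> (?M off_diag o\<^sub>L (T o\<^sub>L ?M off_diag)) =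
          \<psi> (?M off_diag o\<^sub>L T) + \<psi> (T o\<^sub>L ?M off_diag) + \<psi> (?M c)"
        using arg_cong[OF dec(3), of \<psi>] by (simp add: add T mems A.add_mem)
      then show ?thesis using off_null T mems(1) c_null by simp
    qed
    moreover obtain x where "x \<in> carrier A.alg" "\<phi> x \<noteq> 0" using * by blast
    ultimately show False by (metis A.carrier_algE \<psi>_def)
  qed
qed


section \<open>Proper infiniteness of the strictly positive element\<close>

definition root_weight :: "ix \<Rightarrow> complex" where
  "root_weight = (\<lambda>(n, m). of_real (if m = 0 then sqrt (1 / real (Suc n)) else 1))"

text \<open>For \<open>b = 0\<close> and \<open>b = 1\<close> the second coordinates of the children
  are the odd and the positive even numbers: two disjoint ranges that both avoid the base index
  0.\<close>

definition child :: "nat \<Rightarrow> ix \<Rightarrow> ix" where "child b = (\<lambda>(n, m). (n, 2 * m + 1 + b))"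
definition parent :: "nat \<Rightarrow> ix \<Rightarrow> ix" where "parent b = (\<lambda>(n, k). (n, (k - 1 - b) div 2))"

lemma parent_child: "parent b (child b i) = i"
  by (cases i) (simp add: parent_def child_def)

text \<open>This is \<open>d\<^sub>b = h\<^sup>1\<^sup>/\<^sup>2 s\<^sub>b\<^sup>*\<close> of the
  overview, where \<open>s\<^sub>b\<close> is the isometry induced by \<open>child b\<close>;
  \<open>stretch b\<close> is its adjoint. The test in \<open>stretch\<close> discards indices that
  are not children.\<close>

definition squeeze :: "nat \<Rightarrow> ix ell2 \<Rightarrow>\<^sub>L ix ell2" where
  "squeeze b = weighted_comp root_weight (child b)"

definition stretch :: "nat \<Rightarrow> ix ell2 \<Rightarrow>\<^sub>L ix ell2" where
  "stretch b = weighted_comp (\<lambda>j. if child b (parent b j) = j then root_weight (parent b j) else 0) (parent b)"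

lemma root_weight_le: "cmod (root_weight i) \<le> 1"
  by (cases i) (simp add: root_weight_def)

lemma root_weight_facts: "root_weight i \<noteq> 0" "cnj (root_weight i) = root_weight i"
  "root_weight i * root_weight i = strict_weight i"
  by (cases i; simp add: root_weight_def strict_weight_def flip: of_real_mult)+

lemma inj_child: "inj_on (child b) X"
  by (rule inj_on_inverseI[where g = "parent b"]) (rule parent_child)

lemma Rep_squeeze: "Rep_ell2 (squeeze b x) i = root_weight i * Rep_ell2 x (child b i)"
  unfolding squeeze_def by (rule Rep_weighted_comp[OF root_weight_le inj_child])

lemma Rep_stretch: "Rep_ell2 (stretch b x) j =
    (if child b (parent b j) = j then root_weight (parent b j) * Rep_ell2 x (parent b j) else 0)"
proof -
  have "inj_on (parent b) {j. (if child b (parent b j) = j then root_weight (parent b j) else 0) \<noteq> 0}"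
    by (rule inj_on_inverseI[where g = "child b"]) (auto split: if_splits)
  from Rep_weighted_comp[OF _ this, of 1] show ?thesis
    unfolding stretch_def by (simp add: root_weight_le)
qed

lemma has_adj_squeeze: "has_adj (squeeze b) (stretch b)"
  unfolding squeeze_def stretch_def
  by (rule has_adj_weighted_comp[OF root_weight_le])
    (auto simp: root_weight_facts parent_child)

text \<open>No child is a base index, so \<open>squeeze b\<close> kills the base vectors. The
  adjoint maps them to orthogonal vectors scaled by the root of \<open>1 / (n + 1)\<close>; without
  the factor from \<open>h\<close> these would not tend to 0.\<close>

lemma squeeze_mem: "squeeze b \<in> block_ops"
proof (rule block_opsI[OF _ has_adj_squeeze])
  show "clinear_op (squeeze b)"
    unfolding squeeze_def by (rule clinear_weighted_comp[OF root_weight_le inj_child])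
  show "squeeze b o\<^sub>L block n = block n o\<^sub>L squeeze b" for n
    by (intro blinfun_eqI ell2_eqI) (auto simp: Rep_squeeze Rep_block child_def split: prod.splits)
  have "squeeze b (unit0 n) = 0" for n
    by (rule ell2_eqI) (auto simp: Rep_squeeze unit_ell2.rep_eq zero_ell2.rep_eq child_def
        split: prod.splits)
  then show "(\<lambda>n. squeeze b (unit0 n)) \<longlonglongrightarrow> 0" by simp
  have stretch_unit: "stretch b (unit0 n) = scaleC_ell2 (root_weight (n, 0)) (unit_ell2 (child b (n, 0)))" for n
  proof (rule ell2_eqI)
    show "Rep_ell2 (stretch b (unit0 n)) j =
        Rep_ell2 (scaleC_ell2 (root_weight (n, 0)) (unit_ell2 (child b (n, 0)))) j" for j
      by (auto simp: Rep_stretch scaleC_ell2.rep_eq unit_ell2.rep_eq parent_child)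
  qed
  have "(\<lambda>n. sqrt (1 / real (Suc n))) \<longlonglongrightarrow> sqrt 0"
    using LIMSEQ_Suc[OF lim_inverse_n'] by (intro tendsto_real_sqrt) simp
  then show "(\<lambda>n. stretch b (unit0 n)) \<longlonglongrightarrow> 0"
    by (intro tendsto_norm_zero_cancel[of "\<lambda>n. stretch b (unit0 n)"])
      (simp add: stretch_unit norm_scaleC root_weight_def)
qed

text \<open>On the children \<open>h\<close> is the identity, so the product is
  \<open>h\<^sup>1\<^sup>/\<^sup>2 s\<^sub>b\<^sup>* s\<^sub>c h\<^sup>1\<^sup>/\<^sup>2\<close>
  with \<open>c = b'\<close>. The middle factor is 1 or 0.\<close>

lemma squeeze_strict_stretch:
  assumes "b \<in> {0, 1}" "b' \<in> {0, 1}"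
  shows "squeeze b o\<^sub>L mult_op strict_weight o\<^sub>L adj_op (squeeze b') =
    (if b = b' then mult_op strict_weight else 0)"
proof (intro blinfun_eqI ell2_eqI)
  fix x :: "ix ell2" and i :: ix
  have "strict_weight (child b i) = 1" by (cases i) (simp add: child_def strict_weight_def)
  \<comment> \<open>Parity of the second coordinate separates the two kinds of children.\<close>
  moreover have "b' = b" if "child b' (parent b' (child b i)) = child b i"
    using that assms by (cases i) (auto simp: child_def parent_def; presburger)
  ultimately show "Rep_ell2 ((squeeze b o\<^sub>L mult_op strict_weight o\<^sub>L adj_op (squeeze b')) x) i =
      Rep_ell2 ((if b = b' then mult_op strict_weight else 0) x) i"
    by (auto simp: adj_op_eq[OF has_adj_squeeze] Rep_squeeze Rep_stretch zero_ell2.rep_eq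
        Rep_mult_op[OF bounded_weights(3)] parent_child root_weight_facts(3)
        simp flip: mult.assoc)
qed

lemma properly_infinite_strict_weight:
  "properly_infinite_element A.alg (op_code (mult_op strict_weight))"
proof (rule A.properly_infinite_element_alg[OF _ weights_mem(3) squeeze_mem[of 0] squeeze_mem[of 1]])
  show "positive_element A.alg (op_code (mult_op strict_weight))"
    using strictly_positive_strict_weight by (simp add: strictly_positive_def)
qed (simp_all add: squeeze_strict_stretch[of 0 0] squeeze_strict_stretch[of 0 1]
    squeeze_strict_stretch[of 1 0] squeeze_strict_stretch[of 1 1] del: One_nat_def)

section \<open>The unit of the multiplier algebra\<close>

text \<open>Written as left actions, the conclusions say that multipliers \<open>v1\<close>,
  \<open>v2\<close> satisfy \<open>v1 v1* = 1\<close>, \<open>v2 v2* = 1\<close> and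
  \<open>v1 v2* = 0\<close>: their adjoints are isometries with orthogonal ranges.\<close>

lemma (in cstar_algebra) properly_infinite_multiplier_oneE:
  assumes "properly_infinite_projection (multiplier_algebra A) \<one>\<^bsub>multiplier_algebra A\<^esub>"
  obtains L1 R1 L2 R2 where "(L1, R1) \<in> double_centralizers A" "(L2, R2) \<in> double_centralizers A"
    "\<And>x. x \<in> carrier A \<Longrightarrow> L1 (adj A (R1 (adj A x))) = x"
    "\<And>x. x \<in> carrier A \<Longrightarrow> L2 (adj A (R2 (adj A x))) = x"
    "\<And>x. x \<in> carrier A \<Longrightarrow> L1 (adj A (R2 (adj A x))) = \<zero>"
proof -
  let ?M = "multiplier_algebra A"
  obtain v1 v2 where v: "v1 \<in> carrier ?M" "v2 \<in> carrier ?M"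
    and one: "\<one>\<^bsub>?M\<^esub> = v1 \<otimes>\<^bsub>?M\<^esub> adj ?M v1" "\<one>\<^bsub>?M\<^esub> = v2 \<otimes>\<^bsub>?M\<^esub> adj ?M v2"
    and zero: "(adj ?M v1 \<otimes>\<^bsub>?M\<^esub> v1) \<otimes>\<^bsub>?M\<^esub> (adj ?M v2 \<otimes>\<^bsub>?M\<^esub> v2) = \<zero>\<^bsub>?M\<^esub>"
    using assms unfolding properly_infinite_projection_def mvn_equiv_def by metis
  obtain L1 R1 L2 R2 where LR: "v1 = (L1, R1)" "v2 = (L2, R2)" by (cases v1, cases v2)
  have dc: "(L1, R1) \<in> double_centralizers A" "(L2, R2) \<in> double_centralizers A"
    using v by (simp_all add: LR multiplier_algebra_def)
  have mem: "L1 x \<in> carrier A" "L2 x \<in> carrier A" "R1 x \<in> carrier A" "R2 x \<in> carrier A"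
    if "x \<in> carrier A" for x
    using dc that by (auto simp: double_centralizers_def bounded_linear_maps_def)
  let ?w1 = "\<lambda>x. adj A (R1 (adj A x))" and ?w2 = "\<lambda>x. adj A (R2 (adj A x))"
  have w: "?w1 x \<in> carrier A" "?w2 x \<in> carrier A" if "x \<in> carrier A" for x
    using that by (auto intro!: adj_closed mem)
  have id: "L1 (?w1 x) = x" "L2 (?w2 x) = x" if "x \<in> carrier A" for x
    using fun_cong[OF arg_cong[OF one(1), of fst], of x] fun_cong[OF arg_cong[OF one(2), of fst], of x]
      that by (simp_all add: LR multiplier_algebra_def)
  have L1_zero: "L1 \<zero> = \<zero>"
  proof -
    have "L1 (c \<odot> x) = c \<odot> L1 x" if "x \<in> carrier A" for c x
      using dc(1) that by (auto simp: double_centralizers_def bounded_linear_maps_def)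
    from this[OF M.zero_closed, of "\<zero>\<^bsub>complex_ring\<^esub>"] show ?thesis using mem(1)[of \<zero>] by simp
  qed
  have "L1 (?w2 x) = \<zero>" if x: "x \<in> carrier A" for x
  proof -
    \<comment> \<open>The product of the two projections is applied to \<open>v2* x\<close>; then
      \<open>v2 v2* = 1\<close> and multiplication by \<open>v1\<close> from the left remove the
      outer factors.\<close>
    have "?w1 (L1 (?w2 (L2 (?w2 x)))) = \<zero>"
      using fun_cong[OF arg_cong[OF zero, of fst], of "?w2 x"] w(2)[OF x]
      by (simp add: LR multiplier_algebra_def mem w)
    then have "L1 (?w1 (L1 (?w2 x))) = \<zero>" using id(2)[OF x] L1_zero by simp
    then show ?thesis using id(1) mem(1) w(2)[OF x] by simp
  qed
  note ortho = this
  show thesis by (rule that[OF dc id ortho])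
qed

text \<open>Within one block the complement of the range of \<open>q\<close> is the line through
  \<open>unit0 n\<close>, so the inner product splits into two orthogonal parts.\<close>

lemma inner_block:
  assumes "block n x = x"
  shows "inner x y = inner (Rep_ell2 x (n, 0)) (Rep_ell2 y (n, 0)) +
    inner (mult_op off_diag x) (mult_op off_diag y)"
proof -
  have x: "Rep_ell2 x (k, 0) = 0" if "k \<noteq> n" for k
    using Rep_block[of n x "(k, 0)"] assms that by simp
  have "x = scaleC_ell2 (Rep_ell2 x (n, 0)) (unit0 n) + mult_op off_diag x"
  proof (rule ell2_eqI)
    fix i
    show "Rep_ell2 x i = Rep_ell2 (scaleC_ell2 (Rep_ell2 x (n, 0)) (unit0 n) + mult_op off_diag x) i"
      using x[of "fst i"] by (cases i; cases "fst i = n")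
        (auto simp: plus_ell2.rep_eq scaleC_ell2.rep_eq unit_ell2.rep_eq Rep_off_diag)
  qed
  then have "inner x y = inner (Rep_ell2 x (n, 0)) (Rep_ell2 y (n, 0)) + inner (mult_op off_diag x) y"
    by (metis inner_add_left inner_unit_ell2)
  also have "inner (mult_op off_diag x) y = inner (mult_op off_diag x) (mult_op off_diag y)"
    unfolding inner_ell2_def by (rule infsum_cong) (simp add: Rep_off_diag)
  finally show ?thesis .
qed

text \<open>Both vectors lie near the line through \<open>unit0 n\<close>. The scalar
  \<open>c\<close> is needed because the real inner product of \<open>x\<close> and
  \<open>\<i> x\<close> is 0 as well.\<close>

lemma block_vectors_not_orthogonal:
  assumes block: "block n x = x" "block n y = y" and norm: "norm x = 1" "norm y = 1"
    and small: "norm (mult_op off_diag x) < 1/2" "norm (mult_op off_diag y) < 1/2"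
  shows "\<exists>c. inner (scaleC_ell2 c x) y \<noteq> 0"
proof (rule ccontr)
  assume "\<not> ?thesis"
  then have ortho: "inner (scaleC_ell2 c x) y = 0" for c by simp
  define a b where "a = Rep_ell2 x (n, 0)" and "b = Rep_ell2 y (n, 0)"
  have large: "3/4 \<le> (cmod (Rep_ell2 z (n, 0)))\<^sup>2"
    if "block n z = z" "norm z = 1" "norm (mult_op off_diag z) < 1/2" for z
  proof -
    have "1 = (cmod (Rep_ell2 z (n, 0)))\<^sup>2 + (norm (mult_op off_diag z))\<^sup>2"
      using inner_block[OF that(1), of z] that(2) by (simp flip: power2_norm_eq_inner)
    moreover have "(norm (mult_op off_diag z))\<^sup>2 \<le> (1/2)\<^sup>2"
      using that(3) by (intro power_mono) auto
    ultimately show ?thesis by (simp add: power2_eq_square)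
  qed
  \<comment> \<open>This phase makes the contribution of the base coordinates real and at least
    9/16, while the remainder is at most 1/4.\<close>
  define c where "c = b * cnj a"
  have clin: "mult_op off_diag (scaleC_ell2 c x) = scaleC_ell2 c (mult_op off_diag x)"
    using clinear_mult_op[OF bounded_weights(1)] by (simp add: clinear_op_def)
  have "block n (scaleC_ell2 c x) = scaleC_ell2 c x"
    using clinear_mult_op[OF bounded_range_bool[of "\<lambda>i::ix. fst i = n"]] block(1)
    by (simp add: clinear_op_def block_def)
  from inner_block[OF this, of y] ortho[of c]
  have zero: "inner (c * a) b + inner (scaleC_ell2 c (mult_op off_diag x)) (mult_op off_diag y) = 0"
    by (simp add: clin scaleC_ell2.rep_eq a_def b_def)
  have "inner (c * a) b = (cmod a)\<^sup>2 * (cmod b)\<^sup>2"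
    unfolding c_def cmod_power2 by (simp add: inner_complex_def power2_eq_square algebra_simps)
  moreover have "3/4 * (3/4) \<le> (cmod a)\<^sup>2 * (cmod b)\<^sup>2"
    unfolding a_def b_def by (intro mult_mono large assms) auto
  moreover have "\<bar>inner (scaleC_ell2 c (mult_op off_diag x)) (mult_op off_diag y)\<bar> \<le> 1 * (1/2) * (1/2)"
  proof -
    have "cmod a \<le> 1" "cmod b \<le> 1"
      using cmod_Rep_ell2_le[of x] cmod_Rep_ell2_le[of y] norm by (simp_all add: a_def b_def)
    then have "cmod c \<le> 1 * 1" unfolding c_def norm_mult by (intro mult_mono) auto
    have "\<bar>inner (scaleC_ell2 c (mult_op off_diag x)) (mult_op off_diag y)\<bar> \<le>
        cmod c * norm (mult_op off_diag x) * norm (mult_op off_diag y)"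
      using Cauchy_Schwarz_ineq2 by (metis norm_scaleC)
    also have "\<dots> \<le> 1 * (1/2) * (1/2)"
      using \<open>cmod c \<le> 1 * 1\<close> small by (intro mult_mono) auto
    finally show ?thesis .
  qed
  ultimately show False using zero by simp
qed

text \<open>The isometries \<open>v1*\<close>, \<open>v2*\<close> map \<open>unit0 n\<close> to unit
  vectors of block \<open>n\<close> with orthogonal complex spans, yet for large \<open>n\<close>
  both images are close to the line through \<open>unit0 n\<close>.\<close>

lemma multiplier_one_not_properly_infinite:
  "\<not> properly_infinite_projection (multiplier_algebra A.alg) \<one>\<^bsub>multiplier_algebra A.alg\<^esub>"
proof
  interpret cstar_algebra A.alg by (rule A.cstar_algebra_alg)
  let ?q = "mult_op off_diag" and ?c = "carrier A.alg"
  assume "properly_infinite_projection (multiplier_algebra A.alg) \<one>\<^bsub>multiplier_algebra A.alg\<^esub>"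
  then obtain L1 R1 L2 R2 where dc: "(L1, R1) \<in> double_centralizers A.alg" "(L2, R2) \<in> double_centralizers A.alg"
    and id: "\<And>x. x \<in> ?c \<Longrightarrow> L1 (adj A.alg (R1 (adj A.alg x))) = x"
      "\<And>x. x \<in> ?c \<Longrightarrow> L2 (adj A.alg (R2 (adj A.alg x))) = x"
    and ortho: "\<And>x. x \<in> ?c \<Longrightarrow> L1 (adj A.alg (R2 (adj A.alg x))) = \<zero>\<^bsub>A.alg\<^esub>"
    by (rule properly_infinite_multiplier_oneE) (rule that)
  \<comment> \<open>Multipliers act on the algebra and not on vectors, so \<open>unit0 n\<close> is
    replaced by the rank one projection onto it.\<close>
  define f where "f n = mult_op (\<lambda>i. if i = (n, 0::nat) then 1 else (0::complex))" for n :: nat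
  have f_mem: "f n \<in> block_ops" for n
    unfolding f_def
    by (intro mult_op_block_ops bounded_range_bool tendsto_eventually)
      (auto simp: eventually_sequentially intro!: exI[of _ "Suc n"])
  have f_adj: "adj_op (f n) = f n" for n
    unfolding f_def adj_op_mult_op[OF bounded_range_bool] by (simp add: if_distrib[of cnj] cong: if_cong)
  have f_sq: "f n o\<^sub>L f n = f n" for n
    unfolding f_def mult_op_mult[OF bounded_range_bool bounded_range_bool] by (intro arg_cong[of _ _ mult_op]) auto
  have f_unit: "f n (unit0 n) = unit0 n" for n
    unfolding f_def mult_op_unit[OF bounded_range_bool] by simp
  have mult: "R x \<otimes>\<^bsub>A.alg\<^esub> y = x \<otimes>\<^bsub>A.alg\<^esub> L y" "L x \<in> ?c" "R x \<in> ?c"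
    if "(L, R) \<in> double_centralizers A.alg" "x \<in> ?c" "y \<in> ?c" for L R x y
    using that by (auto simp: double_centralizers_def bounded_linear_maps_def)
  have ex: "\<exists>T. T \<in> block_ops \<and> adj A.alg (R (op_code (f n))) = op_code T"
    if "(L, R) \<in> double_centralizers A.alg" for L R n
    using mult(3)[OF that] f_mem adj_closed by (metis A.carrier_algE A.emb_mem_iff)
  \<comment> \<open>\<open>T1 n\<close> and \<open>T2 n\<close> represent \<open>v1* f n\<close> and
    \<open>v2* f n\<close>.\<close>
  obtain T1 where T1: "\<And>n. T1 n \<in> block_ops" "\<And>n. adj A.alg (R1 (op_code (f n))) = op_code (T1 n)"
    using ex[OF dc(1)] by metis
  obtain T2 where T2: "\<And>n. T2 n \<in> block_ops" "\<And>n. adj A.alg (R2 (op_code (f n))) = op_code (T2 n)"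
    using ex[OF dc(2)] by metis
  \<comment> \<open>The double centralizer identity reads \<open>(f n v) T' = f n (v T')\<close>,
    and \<open>f n v\<close> is the adjoint of \<open>T n\<close>.\<close>
  have inner_T: "adj_op (T n) o\<^sub>L T' n = f n o\<^sub>L g"
    if "(L, R) \<in> double_centralizers A.alg" "T n \<in> block_ops" "T' n \<in> block_ops"
      "adj A.alg (R (op_code (f n))) = op_code (T n)" "L (op_code (T' n)) = op_code g"
    for L R T T' g and n :: nat
  proof -
    have "R (op_code (f n)) = op_code (adj_op (T n))"
      using that(4) adj_adj[OF mult(3)[OF that(1)]] f_mem by (metis A.alg_simps(4) A.emb_mem_iff)
    then have "op_code (adj_op (T n) o\<^sub>L T' n) = op_code (f n) \<otimes>\<^bsub>A.alg\<^esub> L (op_code (T' n))"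
      using mult(1)[OF that(1), of "op_code (f n)" "op_code (T' n)"] f_mem that(3) by simp
    then show ?thesis using that(5) by simp
  qed
  have iso: "adj_op (T1 n) o\<^sub>L T1 n = f n" "adj_op (T2 n) o\<^sub>L T2 n = f n" "adj_op (T1 n) o\<^sub>L T2 n = 0" for n
  proof -
    have "L1 (op_code (T1 n)) = op_code (f n)" "L2 (op_code (T2 n)) = op_code (f n)"
      "L1 (op_code (T2 n)) = op_code 0"
      using id[of "op_code (f n)"] ortho[of "op_code (f n)"] f_mem[of n]
      by (simp_all add: f_adj T1(2) T2(2))
    then show "adj_op (T1 n) o\<^sub>L T1 n = f n" "adj_op (T2 n) o\<^sub>L T2 n = f n" "adj_op (T1 n) o\<^sub>L T2 n = 0"
      using inner_T[of L1 R1 T1 n T1 "f n"] inner_T[of L2 R2 T2 n T2 "f n"] inner_T[of L1 R1 T1 n T2 0]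
        dc T1 T2 by (simp_all add: f_sq)
  qed
  have block_T: "block n (T (unit0 n)) = T (unit0 n)" if "T \<in> block_ops"
    for T :: "ix ell2 \<Rightarrow>\<^sub>L ix ell2" and n
  proof -
    have "block n (unit0 n) = unit0 n" by (rule ell2_eqI) (auto simp: Rep_block unit_ell2.rep_eq)
    then show ?thesis using block_opsD(3)[OF that, of n] by (metis blinfun_apply_blinfun_compose)
  qed
  have inner_adj: "inner (T x) (T' y) = inner x ((adj_op T o\<^sub>L T') y)" if "T \<in> block_ops"
    for T T' :: "ix ell2 \<Rightarrow>\<^sub>L ix ell2" and x y
    using block_opsD(2)[OF that] by (simp add: has_adj_def)
  have norm_T: "norm (T (unit0 n)) = 1" if "T \<in> block_ops" "adj_op T o\<^sub>L T = f n"
    for T :: "ix ell2 \<Rightarrow>\<^sub>L ix ell2" and n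
    using inner_adj[OF that(1), of "unit0 n" T "unit0 n"] norm_unit_ell2[of "(n, 0)"]
    by (simp add: that(2) f_unit norm_eq_sqrt_inner)
  have small: "\<forall>\<^sub>F n in sequentially. norm (?q (T n (unit0 n))) < 1/2"
    if dc: "(L, R) \<in> double_centralizers A.alg" and T: "\<And>n. T n \<in> block_ops"
      "\<And>n. adj A.alg (R (op_code (f n))) = op_code (T n)"
    for L R and T :: "nat \<Rightarrow> ix ell2 \<Rightarrow>\<^sub>L ix ell2"
  proof -
    \<comment> \<open>\<open>B\<close> represents \<open>v q\<close>, a member of the algebra; hence
      \<open>q v*\<close> is its adjoint and sends \<open>unit0 n\<close> to a null
      sequence.\<close>
    obtain B where B: "L (op_code ?q) = op_code B" "B \<in> block_ops"
      using mult(2)[OF dc, of "op_code ?q"] weights_mem(1) by (metis A.carrier_algE A.emb_mem_iff)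
    have adj_q: "has_adj ?q ?q"
    proof -
      have "(\<lambda>i. cnj (off_diag i)) = off_diag" by (auto simp: off_diag_def)
      then show ?thesis using has_adj_mult_op[OF bounded_weights(1)] by simp
    qed
    have eq: "?q o\<^sub>L T n = adj_op B o\<^sub>L f n" for n
    proof -
      have "adj_op (T n) o\<^sub>L ?q = f n o\<^sub>L B"
        using inner_T[of L R T n "\<lambda>_. ?q" B] dc T B weights_mem(1) by simp
      moreover have "has_adj (adj_op (T n) o\<^sub>L ?q) (?q o\<^sub>L T n)"
        by (intro has_adj_compose adj_q has_adj_sym[OF block_opsD(2)[OF T(1)]])
      moreover have "has_adj (f n o\<^sub>L B) (adj_op B o\<^sub>L f n)"
        using has_adj_compose[OF block_opsD(2)[OF f_mem] block_opsD(2)[OF B(2)]] by (simp add: f_adj)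
      ultimately show ?thesis using has_adj_unique by metis
    qed
    have q_T: "?q (T n (unit0 n)) = adj_op B (unit0 n)" for n
      using arg_cong[OF eq[of n], of "\<lambda>S. S (unit0 n)"] by (simp add: f_unit)
    have lim: "(\<lambda>n. norm (adj_op B (unit0 n))) \<longlonglongrightarrow> 0"
      by (rule tendsto_norm_zero[OF block_opsD(5)[OF B(2)]])
    show ?thesis unfolding q_T by (rule order_tendstoD(2)[OF lim]) simp
  qed
  have "\<forall>\<^sub>F n in sequentially. norm (?q (T1 n (unit0 n))) < 1/2 \<and> norm (?q (T2 n (unit0 n))) < 1/2"
    by (intro eventually_conj small[OF dc(1) T1] small[OF dc(2) T2])
  then obtain n where n: "norm (?q (T1 n (unit0 n))) < 1/2" "norm (?q (T2 n (unit0 n))) < 1/2"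
    by (auto simp: eventually_sequentially)
  obtain c where "inner (scaleC_ell2 c (T1 n (unit0 n))) (T2 n (unit0 n)) \<noteq> 0"
    using block_vectors_not_orthogonal[OF block_T block_T norm_T norm_T n] T1(1) T2(1) iso by metis
  moreover have "inner (scaleC_ell2 c (T1 n (unit0 n))) (T2 n (unit0 n)) =
      inner (T1 n (scaleC_ell2 c (unit0 n))) (T2 n (unit0 n))"
    using block_opsD(1)[OF T1(1)] by (simp add: clinear_op_def)
  moreover have "\<dots> = 0" by (simp add: inner_adj[OF T1(1)] iso)
  ultimately show False by simp
qed

theorem mainTheorem13:
  shows "\<exists>A :: ((nat \<Rightarrow> complex) \<Rightarrow> (nat \<Rightarrow> complex)) cstar_struct.
    cstar_algebra A \<and>
    (\<exists>h\<in>carrier A. strictly_positive A h \<and> properly_infinite_element A h) \<and>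
    \<not> properly_infinite_projection (multiplier_algebra A) \<one>\<^bsub>multiplier_algebra A\<^esub>"
proof (intro exI conjI bexI)
  show "cstar_algebra A.alg" by (rule A.cstar_algebra_alg)
  show "strictly_positive A.alg (op_code (mult_op strict_weight))"
    by (rule strictly_positive_strict_weight)
  show "properly_infinite_element A.alg (op_code (mult_op strict_weight))"
    by (rule properly_infinite_strict_weight)
  show "op_code (mult_op strict_weight) \<in> carrier A.alg" using weights_mem(3) by simp
  show "\<not> properly_infinite_projection (multiplier_algebra A.alg) \<one>\<^bsub>multiplier_algebra A.alg\<^esub>"
    by (rule multiplier_one_not_properly_infinite)
qed

end
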